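(* For every sequence $\bar a=(a(1),a(2),\dots)$ with $0\le a(i)<1$ for all $i$, there is a sequence $(f(i))_{i\ge1}$ of natural numbers such that for every sequence $\bar p$ obtained from $\bar a$ by inserting, for every $i\ge 1$, more than $f(i)$ (finitely many) zeros right after the $i$-th term of $\bar a$, and for each first order sentence $\psi$ from $L$, a zero-one law holds, i.e. $\lim_{n\to\infty}\mathrm{Prob}(n,\bar p;\psi)$ exists and equals $0$ or $1$.
   Context: For a sequence $\bar p=(p(1),p(2),\dots)$ with $0\le p(i)\le 1$, $G(n,\bar p)$ is the random graph with vertex set $[n]=\{1,\dots,n\}$ in which each pair of distinct vertices $v,w$ is an edge with probability $p(|v-w|)$, independently for each pair. $L$ is the first order language of graphs: first order logic with equality whose only other predicate is the binary adjacency predicate. $\mathrm{Prob}(n,\bar p;\psi)$ denotes the probability that $G(n,\bar p)$ satisfies the sentence $\psi$. Explicitly, $\bar p$ is obtained from $\bar a$ by inserting $g(i)$ zeros after the $i$-th term for each $i$ if $p\left(i+\sum_{j<i}g(j)\right)=a(i)$ for all $i\ge1$ and $p(m)=0$ for all other $m$; here it is required that $g(i)>f(i)$ for all $i$. *)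

theory Defs
  imports "HOL-Probability.Probability"
begin

text \<open>The first order language of graphs. Variables are named by natural numbers; the remaining
  connectives and the universal quantifier are the usual abbreviations.\<close>

datatype fo_formula =
    Equal nat nat
  | Adj nat nat
  | Neg fo_formula
  | Conj fo_formula fo_formula
  | Exists nat fo_formula

fun free_vars :: "fo_formula \<Rightarrow> nat set" where
  "free_vars (Equal x y) = {x, y}"
| "free_vars (Adj x y) = {x, y}"
| "free_vars (Neg \<phi>) = free_vars \<phi>"
| "free_vars (Conj \<phi> \<psi>) = free_vars \<phi> \<union> free_vars \<psi>"
| "free_vars (Exists x \<phi>) = free_vars \<phi> - {x}"

definition sentence :: "fo_formula \<Rightarrow> bool" where
  "sentence \<psi> \<longleftrightarrow> free_vars \<psi> = {}"

text \<open>A graph has a vertex set \<open>V\<close> and a set \<open>E\<close> of edges, each a two-element subset of \<open>V\<close>.\<close>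

fun sat :: "'v set \<Rightarrow> 'v set set \<Rightarrow> (nat \<Rightarrow> 'v) \<Rightarrow> fo_formula \<Rightarrow> bool" where
  "sat V E \<sigma> (Equal x y) \<longleftrightarrow> \<sigma> x = \<sigma> y"
| "sat V E \<sigma> (Adj x y) \<longleftrightarrow> {\<sigma> x, \<sigma> y} \<in> E"
| "sat V E \<sigma> (Neg \<phi>) \<longleftrightarrow> \<not> sat V E \<sigma> \<phi>"
| "sat V E \<sigma> (Conj \<phi> \<psi>) \<longleftrightarrow> sat V E \<sigma> \<phi> \<and> sat V E \<sigma> \<psi>"
| "sat V E \<sigma> (Exists x \<phi>) \<longleftrightarrow> (\<exists>v\<in>V. sat V E (\<sigma>(x := v)) \<phi>)"

text \<open>For a sentence the choice of the assignment is immaterial as soon as \<open>V\<close> is nonempty.\<close>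

definition satisfies :: "'v set \<Rightarrow> 'v set set \<Rightarrow> fo_formula \<Rightarrow> bool" where
  "satisfies V E \<psi> \<longleftrightarrow> (\<forall>\<sigma>. range \<sigma> \<subseteq> V \<longrightarrow> sat V E \<sigma> \<psi>)"

definition vertex_pairs :: "nat \<Rightarrow> nat set set" where
  "vertex_pairs n = {e. e \<subseteq> {1..n} \<and> card e = 2}"

text \<open>The distribution of the edge set of \<open>G(n, p)\<close>. For \<open>e = {v, w}\<close> the number \<open>Max e - Min e\<close>
  is \<open>\<bar>v - w\<bar>\<close>. Sequences are indexed from 1 on: the value at 0 is never used.\<close>

definition random_graph :: "nat \<Rightarrow> (nat \<Rightarrow> real) \<Rightarrow> nat set set pmf" where
  "random_graph n p =
     map_pmf (\<lambda>X. {e. X e})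
       (Pi_pmf (vertex_pairs n) False (\<lambda>e. bernoulli_pmf (p (Max e - Min e))))"

definition Prob :: "nat \<Rightarrow> (nat \<Rightarrow> real) \<Rightarrow> fo_formula \<Rightarrow> real" where
  "Prob n p \<psi> = measure_pmf.prob (random_graph n p) {E. satisfies {1..n} E \<psi>}"

definition zero_one_law :: "(nat \<Rightarrow> real) \<Rightarrow> fo_formula \<Rightarrow> bool" where
  "zero_one_law p \<psi> \<longleftrightarrow>
     ((\<lambda>n. Prob n p \<psi>) \<longlonglongrightarrow> 0) \<or> ((\<lambda>n. Prob n p \<psi>) \<longlonglongrightarrow> 1)"

text \<open>\<open>p\<close> arises from \<open>a\<close> by inserting \<open>g i\<close> zeros right after the \<open>i\<close>-th term, for every \<open>i\<close>.\<close>

definition inserts_zeros :: "(nat \<Rightarrow> real) \<Rightarrow> (nat \<Rightarrow> nat) \<Rightarrow> (nat \<Rightarrow> real) \<Rightarrow> bool" where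
  "inserts_zeros a g p \<longleftrightarrow>
     (\<forall>i\<ge>1. p (i + (\<Sum>j=1..<i. g j)) = a i) \<and>
     (\<forall>m\<ge>1. (\<forall>i\<ge>1. m \<noteq> i + (\<Sum>j=1..<i. g j)) \<longrightarrow> p m = 0)"

end

theory Submission
  imports Defs
begin

text \<open>
  The reason for the zero-one law is that a large random graph contains, not joined to anything
  else, many copies of every small graph that can occur at all, and that these copies swallow the
  rest.

  Fix a depth \<open>k\<close> of the Ehrenfeucht-Fraisse game. Suppose that a graph \<open>G\<close> contains \<open>k\<close> isolated
  pieces, each equivalent to a graph \<open>H\<close> in the \<open>k\<close>-round game. Then \<open>G\<close> is equivalent to its
  disjoint union with \<open>H\<close>, since a player with \<open>k\<close> moves cannot tell \<open>k\<close> copies from more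
  (\<open>ef_equiv_absorb\<close>). Up to equivalence there are only finitely many graphs
  (\<open>ef_equiv_finite_representatives\<close>). So choose finitely many graphs of positive probability that
  represent all types of such graphs, and let \<open>G\<close> be rich if it has positive probability and
  contains \<open>k\<close> isolated copies of each of them. The decisive observation is that a rich graph \<open>G'\<close>
  has itself positive probability, hence is equivalent to one of the representatives and is
  absorbed by \<open>G\<close>. By symmetry \<open>G\<close> and \<open>G'\<close> are both equivalent to their disjoint union, and
  therefore to each other (\<open>ef_equiv_mutual_absorb\<close>). All rich graphs, of whatever size, satisfy
  the same sentences of bounded depth, and it remains to see that the random graph is rich with
  probability tending to \<open>1\<close>.

  A given interval of length \<open>m\<close> carries an isolated copy of a given graph with probability at least
  a constant times the \<open>2 m\<close>-th power of the product of all \<open>1 - p d\<close> for \<open>d < n\<close>. Because few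
  distances have positive probability, one can select many intervals with no possible edge between
  them, and for these the events are independent (\<open>prob_no_isolated_copy_le\<close>). So it suffices that \<open>n\<close>
  grows faster than every power of the reciprocal of that product, times the number of possible
  distances below \<open>n\<close>. If exactly the first \<open>l\<close> terms of \<open>a\<close> correspond to distances below \<open>n\<close>,
  both quantities are determined by \<open>a\<close> and \<open>l\<close> alone, whereas \<open>n\<close> is larger than \<open>f (l - 1)\<close>. A sufficiently
  fast growing \<open>f\<close> thus enforces the condition, however unevenly the zeros are inserted.
\<close>

section \<open>Ehrenfeucht-Fraisse equivalence\<close>

definition partial_iso :: "'a set set \<Rightarrow> 'b set set \<Rightarrow> ('a \<times> 'b) set \<Rightarrow> bool" where
  "partial_iso E E' P \<longleftrightarrow>
     (\<forall>a b a' b'. (a, b) \<in> P \<longrightarrow> (a', b') \<in> P \<longrightarrow>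
        (a = a' \<longleftrightarrow> b = b') \<and> ({a, a'} \<in> E \<longleftrightarrow> {b, b'} \<in> E'))"

text \<open>A position of the game is the set \<open>P\<close> of all pairs chosen so far; the order of the moves is
  forgotten. Hence the part of a position inside two subgraphs is a mere intersection, which is what
  the strategy on disjoint unions needs. The graphs may have different vertex types. Every stage asks
  for a partial isomorphism, so that this also holds when there is no vertex to move to.\<close>

fun ef_equiv :: "nat \<Rightarrow> 'a set \<Rightarrow> 'a set set \<Rightarrow> 'b set \<Rightarrow> 'b set set \<Rightarrow> ('a \<times> 'b) set \<Rightarrow> bool" where
  "ef_equiv 0 V E V' E' P \<longleftrightarrow> partial_iso E E' P"
| "ef_equiv (Suc k) V E V' E' P \<longleftrightarrow> partial_iso E E' P \<and>
     (\<forall>v\<in>V. \<exists>w\<in>V'. ef_equiv k V E V' E' (insert (v, w) P)) \<and>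
     (\<forall>w\<in>V'. \<exists>v\<in>V. ef_equiv k V E V' E' (insert (v, w) P))"

lemma partial_iso_converse: "partial_iso E E' P \<Longrightarrow> partial_iso E' E (P\<inverse>)"
  unfolding partial_iso_def by simp

lemma ef_equiv_partial_iso: "ef_equiv k V E V' E' P \<Longrightarrow> partial_iso E E' P"
  by (cases k) auto

lemma ef_equiv_Suc_imp: "ef_equiv (Suc k) V E V' E' P \<Longrightarrow> ef_equiv k V E V' E' P"
proof (induction k arbitrary: P)
  case 0
  then show ?case by simp
next
  case (Suc k)
  then show ?case by (subst ef_equiv.simps(2)) (metis ef_equiv.simps(2))
qed

lemma ef_equiv_converse: "ef_equiv k V E V' E' P \<Longrightarrow> ef_equiv k V' E' V E (P\<inverse>)"
proof (induction k arbitrary: P)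
  case 0
  then show ?case by (simp add: partial_iso_converse)
next
  case (Suc k)
  have conv: "insert (w, v) (P\<inverse>) = (insert (v, w) P)\<inverse>" for v w
    by auto
  show ?case
    using Suc.prems Suc.IH by (simp add: conv partial_iso_converse) meson
qed

lemma partial_iso_trans:
  assumes "partial_iso E E' P" "partial_iso E' E'' Q" "R \<subseteq> P O Q"
  shows "partial_iso E E'' R"
  unfolding partial_iso_def
proof (intro allI impI)
  fix a c a' c' assume "(a, c) \<in> R" "(a', c') \<in> R"
  then obtain b b' where "(a, b) \<in> P" "(b, c) \<in> Q" "(a', b') \<in> P" "(b', c') \<in> Q"
    using assms(3) by blast
  then show "(a = a' \<longleftrightarrow> c = c') \<and> ({a, a'} \<in> E \<longleftrightarrow> {c, c'} \<in> E'')"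
    using assms(1,2) unfolding partial_iso_def by blast
qed

text \<open>Spoiler's move in the first graph is answered in the second, and the answer is fed into the
  strategy for the second and the third. Passing to a subset \<open>R\<close> is allowed because inserting
  \<open>(u, v)\<close> and \<open>(v, w)\<close> may create further composed pairs than \<open>(u, w)\<close>.\<close>

lemma ef_equiv_trans:
  assumes "ef_equiv k V E V' E' P" "ef_equiv k V' E' V'' E'' Q" "R \<subseteq> P O Q"
  shows "ef_equiv k V E V'' E'' R"
  using assms
proof (induction k arbitrary: P Q R)
  case 0
  then show ?case using partial_iso_trans by fastforce
next
  case (Suc k)
  have iso: "partial_iso E E'' R"
    using Suc.prems partial_iso_trans ef_equiv_partial_iso by metis
  have sub: "insert (u, w) R \<subseteq> insert (u, v) P O insert (v, w) Q" for u v w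
    using Suc.prems(3) by blast
  have "\<exists>w\<in>V''. ef_equiv k V E V'' E'' (insert (u, w) R)" if "u \<in> V" for u
  proof -
    from that Suc.prems(1) obtain v where v: "v \<in> V'" "ef_equiv k V E V' E' (insert (u, v) P)"
      by auto
    from v(1) Suc.prems(2) obtain w where "w \<in> V''" "ef_equiv k V' E' V'' E'' (insert (v, w) Q)"
      by auto
    then show ?thesis using Suc.IH[OF v(2) _ sub] by blast
  qed
  moreover have "\<exists>u\<in>V. ef_equiv k V E V'' E'' (insert (u, w) R)" if "w \<in> V''" for w
  proof -
    from that Suc.prems(2) obtain v where v: "v \<in> V'" "ef_equiv k V' E' V'' E'' (insert (v, w) Q)"
      by auto
    from v(1) Suc.prems(1) obtain u where "u \<in> V" "ef_equiv k V E V' E' (insert (u, v) P)"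
      by auto
    then show ?thesis using Suc.IH[OF _ v(2) sub] by blast
  qed
  ultimately show ?case using iso by simp
qed

lemma ef_equiv_graph_iso:
  assumes bij: "bij_betw h V V'"
    and edges: "\<And>x y. x \<in> V \<Longrightarrow> y \<in> V \<Longrightarrow> {x, y} \<in> E \<longleftrightarrow> {h x, h y} \<in> E'"
    and P: "\<And>a b. (a, b) \<in> P \<Longrightarrow> a \<in> V \<and> b = h a"
  shows "ef_equiv k V E V' E' P"
  using P
proof (induction k arbitrary: P)
  have iso: "partial_iso E E' P" if "\<And>a b. (a, b) \<in> P \<Longrightarrow> a \<in> V \<and> b = h a" for P
    using that edges bij unfolding partial_iso_def bij_betw_def inj_on_def by metis
  {
    case 0
    then show ?case using iso by simp
  next
    case (Suc k)
    have "ef_equiv k V E V' E' (insert (v, h v) P)" if "v \<in> V" for v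
      using that Suc.prems by (intro Suc.IH) auto
    moreover have "h ` V = V'"
      using bij by (simp add: bij_betw_def)
    ultimately show ?case using iso[OF Suc.prems] by auto
  }
qed

fun quantifier_depth :: "fo_formula \<Rightarrow> nat" where
  "quantifier_depth (Equal x y) = 0"
| "quantifier_depth (Adj x y) = 0"
| "quantifier_depth (Neg \<phi>) = quantifier_depth \<phi>"
| "quantifier_depth (Conj \<phi> \<psi>) = max (quantifier_depth \<phi>) (quantifier_depth \<psi>)"
| "quantifier_depth (Exists x \<phi>) = Suc (quantifier_depth \<phi>)"

lemma ef_equiv_sat:
  assumes "ef_equiv k V E V' E' P" "quantifier_depth \<phi> \<le> k"
    and "\<And>x. x \<in> free_vars \<phi> \<Longrightarrow> (\<sigma> x, \<tau> x) \<in> P"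
  shows "sat V E \<sigma> \<phi> \<longleftrightarrow> sat V' E' \<tau> \<phi>"
  using assms
proof (induction \<phi> arbitrary: k P \<sigma> \<tau>)
  case (Equal x y)
  then show ?case using ef_equiv_partial_iso[OF Equal(1)] unfolding partial_iso_def by auto
next
  case (Adj x y)
  then show ?case using ef_equiv_partial_iso[OF Adj(1)] unfolding partial_iso_def by auto
next
  case (Neg \<phi>)
  then show ?case using Neg.IH[OF Neg.prems(1)] by simp
next
  case (Conj \<phi> \<psi>)
  have "sat V E \<sigma> \<phi> \<longleftrightarrow> sat V' E' \<tau> \<phi>"
    using Conj.prems by (intro Conj.IH(1)[OF Conj.prems(1)]) auto
  moreover have "sat V E \<sigma> \<psi> \<longleftrightarrow> sat V' E' \<tau> \<psi>"
    using Conj.prems by (intro Conj.IH(2)[OF Conj.prems(1)]) auto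
  ultimately show ?case by simp
next
  case (Exists x \<phi>)
  then obtain l where l: "k = Suc l" "quantifier_depth \<phi> \<le> l"
    by (cases k) auto
  have step: "sat V E (\<sigma>(x := v)) \<phi> \<longleftrightarrow> sat V' E' (\<tau>(x := w)) \<phi>"
    if "ef_equiv l V E V' E' (insert (v, w) P)" for v w
    using Exists.prems(3) by (intro Exists.IH[OF that l(2)]) auto
  show ?case
    using Exists.prems(1) step unfolding l(1) by (simp, blast)
qed

lemma ef_equiv_satisfies:
  assumes "ef_equiv k V E V' E' {}" "quantifier_depth \<psi> \<le> k" "sentence \<psi>" "V \<noteq> {}" "V' \<noteq> {}"
  shows "satisfies V E \<psi> \<longleftrightarrow> satisfies V' E' \<psi>"
proof -
  have eq: "sat V E \<sigma> \<psi> \<longleftrightarrow> sat V' E' \<tau> \<psi>" for \<sigma> \<tau>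
    using assms(2,3) by (intro ef_equiv_sat[OF assms(1)]) (auto simp: sentence_def)
  from assms obtain v w where "v \<in> V" "w \<in> V'" by blast
  then have "range (\<lambda>_::nat. v) \<subseteq> V" "range (\<lambda>_::nat. w) \<subseteq> V'" by auto
  then show ?thesis unfolding satisfies_def using eq by metis
qed

section \<open>Finiteness of the set of types\<close>

text \<open>Recodes an invariant with finitely many values, of whatever type, by a natural number; this is
  what keeps the coding of types uniform in the depth.\<close>

lemma finite_range_compress:
  fixes t :: "'s \<Rightarrow> 'b"
  assumes "finite (range t)"
  shows "\<exists>u :: 's \<Rightarrow> nat. finite (range u) \<and> (\<forall>s s'. u s = u s' \<longrightarrow> t s = t s')"
proof -
  obtain f :: "'b \<Rightarrow> nat" and n where "inj_on f (range t)"
    using finite_imp_inj_to_nat_seg[OF assms] by blast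
  moreover have "finite (range (f \<circ> t))"
    using finite_imageI[OF assms, of f] by (simp add: image_comp)
  ultimately show ?thesis
    by (intro exI[of _ "f \<circ> t"]) (simp add: inj_on_def)
qed

text \<open>Types are coded by natural numbers, so that types of all depths live in one Isabelle type. The
  type of depth \<open>k + 1\<close> of a tuple is its atomic diagram together with the set of types of depth
  \<open>k\<close> of its one-point extensions; a set of finitely many types is again one of finitely many
  objects. Positions are lists here, since the positions of different graphs have to be indexed
  uniformly before they can be compared.\<close>

lemma ef_equiv_finite_type_lists:
  "\<exists>t :: 'a set \<times> 'a set set \<times> 'a list \<Rightarrow> nat. finite (range t) \<and>
     (\<forall>V E xs V' E' ys. length xs = m \<longrightarrow> length ys = m \<longrightarrow> t (V, E, xs) = t (V', E', ys) \<longrightarrow>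
        ef_equiv k V E V' E' (set (zip xs ys)))"
proof (induction k arbitrary: m)
  define d :: "nat \<Rightarrow> 'a set \<times> 'a set set \<times> 'a list \<Rightarrow> (nat \<times> nat) set \<times> (nat \<times> nat) set"
    where "d = (\<lambda>m (V, E, xs). ({(i, j). i < m \<and> j < m \<and> xs ! i = xs ! j},
                            {(i, j). i < m \<and> j < m \<and> {xs ! i, xs ! j} \<in> E}))"
  have fin_d: "finite (range (d m))" for m
    by (rule finite_subset[of _ "Pow ({..<m} \<times> {..<m}) \<times> Pow ({..<m} \<times> {..<m})"])
       (auto simp: d_def)
  have iso_d: "partial_iso E E' (set (zip xs ys))"
    if len: "length xs = m" "length ys = m" and eq: "d m (V, E, xs) = d m (V', E', ys)" for V E xs V' E' ys m
    unfolding partial_iso_def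
  proof (intro allI impI)
    fix a b a' b' assume "(a, b) \<in> set (zip xs ys)" "(a', b') \<in> set (zip xs ys)"
    then obtain i j where ij: "i < m" "j < m"
      "a = xs ! i" "b = ys ! i" "a' = xs ! j" "b' = ys ! j"
      using len by (auto simp: set_zip)
    have "{(i, j). i < m \<and> j < m \<and> xs ! i = xs ! j} = {(i, j). i < m \<and> j < m \<and> ys ! i = ys ! j}"
      "{(i, j). i < m \<and> j < m \<and> {xs ! i, xs ! j} \<in> E} =
       {(i, j). i < m \<and> j < m \<and> {ys ! i, ys ! j} \<in> E'}"
      using eq by (simp_all add: d_def)
    then show "(a = a' \<longleftrightarrow> b = b') \<and> ({a, a'} \<in> E \<longleftrightarrow> {b, b'} \<in> E')"
      using ij by blast
  qed
  {
    case 0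
    obtain u :: "'a set \<times> 'a set set \<times> 'a list \<Rightarrow> nat"
      where u: "finite (range u)" "\<And>s s'. u s = u s' \<Longrightarrow> d m s = d m s'"
      using finite_range_compress[OF fin_d[of m]] by blast
    show ?case
    proof (intro exI[of _ u] conjI allI impI)
      fix V E xs V' E' and ys :: "'a list"
      assume len: "length xs = m" "length ys = m" and "u (V, E, xs) = u (V', E', ys)"
      then have "d m (V, E, xs) = d m (V', E', ys)" by (intro u(2))
      then show "ef_equiv 0 V E V' E' (set (zip xs ys))"
        using iso_d[OF len] by simp
    qed (use u in auto)
  next
    case (Suc k)
    from Suc.IH[of "Suc m"] obtain t :: "'a set \<times> 'a set set \<times> 'a list \<Rightarrow> nat" where
      t: "finite (range t)" and
      eq: "\<And>V E xs V' E' ys. length xs = Suc m \<Longrightarrow> length ys = Suc m \<Longrightarrow>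
            t (V, E, xs) = t (V', E', ys) \<Longrightarrow> ef_equiv k V E V' E' (set (zip xs ys))"
      by blast
    define e where "e = (\<lambda>(V, E, xs). (d m (V, E, xs), (\<lambda>v. t (V, E, v # xs)) ` V))"
    have fin_e: "finite (range e)"
      by (rule finite_subset[of _ "range (d m) \<times> Pow (range t)"])
         (use t fin_d in \<open>auto simp: e_def\<close>)
    obtain u :: "'a set \<times> 'a set set \<times> 'a list \<Rightarrow> nat"
      where u: "finite (range u)" "\<And>s s'. u s = u s' \<Longrightarrow> e s = e s'"
      using finite_range_compress[OF fin_e] by blast
    show ?case
    proof (intro exI[of _ u] conjI allI impI)
      fix V E xs V' E' and ys :: "'a list"
      assume len: "length xs = m" "length ys = m" and "u (V, E, xs) = u (V', E', ys)"
      then have "e (V, E, xs) = e (V', E', ys)" by (intro u(2))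
      then have d: "d m (V, E, xs) = d m (V', E', ys)"
        and im: "(\<lambda>v. t (V, E, v # xs)) ` V = (\<lambda>v. t (V', E', v # ys)) ` V'"
        by (auto simp: e_def)
      have step: "ef_equiv k V E V' E' (insert (v, w) (set (zip xs ys)))"
        if "t (V, E, v # xs) = t (V', E', w # ys)" for v w
        using eq[of "v # xs" "w # ys", OF _ _ that] len by simp
      have "\<exists>w\<in>V'. ef_equiv k V E V' E' (insert (v, w) (set (zip xs ys)))" if "v \<in> V" for v
        using that im step by (metis (no_types, lifting) image_iff)
      moreover have "\<exists>v\<in>V. ef_equiv k V E V' E' (insert (v, w) (set (zip xs ys)))" if "w \<in> V'" for w
        using that im step by (metis (no_types, lifting) image_iff)
      ultimately show "ef_equiv (Suc k) V E V' E' (set (zip xs ys))"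
        using iso_d[OF len d] by simp
    qed (use u in auto)
  }
qed

lemma ef_equiv_finite_representatives:
  fixes \<G> :: "('a set \<times> 'a set set) set"
  obtains \<C> where "finite \<C>" "\<C> \<subseteq> \<G>"
    "\<And>V E. (V, E) \<in> \<G> \<Longrightarrow> \<exists>(V', E')\<in>\<C>. ef_equiv k V' E' V E {}"
proof -
  from ef_equiv_finite_type_lists[of 0 k, where 'a = 'a]
  obtain t :: "'a set \<times> 'a set set \<times> 'a list \<Rightarrow> nat" where fin: "finite (range t)" and
    "\<forall>V E xs V' E' ys. length xs = 0 \<longrightarrow> length ys = 0 \<longrightarrow> t (V, E, xs) = t (V', E', ys) \<longrightarrow>
       ef_equiv k V E V' E' (set (zip xs ys))"
    by blast
  then have t: "ef_equiv k V E V' E' {}" if "t (V, E, []) = t (V', E', [])" for V E V' E'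
    using that by fastforce
  define s where "s = (\<lambda>(V, E). t (V, E, []))"
  have "finite (s ` \<G>)"
    by (rule finite_subset[OF _ fin]) (auto simp: s_def)
  then obtain \<C> where \<C>: "\<C> \<subseteq> \<G>" "finite \<C>" "s ` \<G> = s ` \<C>"
    using finite_subset_image[of "s ` \<G>" s \<G>] by auto
  have "\<exists>(V', E')\<in>\<C>. ef_equiv k V' E' V E {}" if "(V, E) \<in> \<G>" for V E
  proof -
    from that \<C>(3) obtain V' E' where "(V', E') \<in> \<C>" "s (V', E') = s (V, E)" by (metis imageE imageI surj_pair)
    then show ?thesis using t by (force simp: s_def)
  qed
  with \<C> show ?thesis using that by blast
qed

section \<open>The game on a disjoint union\<close>

definition piece :: "('a \<Rightarrow> 'i) \<Rightarrow> 'a set \<Rightarrow> 'i \<Rightarrow> 'a set" where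
  "piece c V i = {x \<in> V. c x = i}"

definition no_crossing :: "('a \<Rightarrow> 'i) \<Rightarrow> 'a set \<Rightarrow> 'a set set \<Rightarrow> bool" where
  "no_crossing c V E \<longleftrightarrow> (\<forall>x\<in>V. \<forall>y\<in>V. {x, y} \<in> E \<longrightarrow> c x = c y)"

text \<open>The invariant of Duplicator's strategy between two graphs cut into pieces without edges between
  different pieces. The relation \<open>\<pi>\<close> matches the pieces already in play, and inside matched pieces
  Duplicator is in a winning position for the remaining \<open>k\<close> rounds. Every unmatched
  piece of one graph is equivalent to every unmatched piece of the other, and at least \<open>k\<close> of them
  are left on either side: a round uses up at most one of them, so a partner for a new piece is
  always available. The numbers of unmatched pieces need not agree, and this is what makes extra copies invisible.\<close>

locale glued =
  fixes k :: nat
    and c :: "'a \<Rightarrow> 'i" and I :: "'i set" and V :: "'a set" and E :: "'a set set"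
    and c' :: "'b \<Rightarrow> 'j" and J :: "'j set" and V' :: "'b set" and E' :: "'b set set"
    and \<pi> :: "('i \<times> 'j) set" and P :: "('a \<times> 'b) set"
  assumes crossing: "no_crossing c V E" "no_crossing c' V' E'"
    and indices: "c ` V \<subseteq> I" "c' ` V' \<subseteq> J" "finite I" "finite J"
    and matching: "(i, j) \<in> \<pi> \<Longrightarrow> (i', j') \<in> \<pi> \<Longrightarrow> i = i' \<longleftrightarrow> j = j'"
    and position: "(a, b) \<in> P \<Longrightarrow> a \<in> V \<and> b \<in> V' \<and> (c a, c' b) \<in> \<pi>"
    and matched: "(i, j) \<in> \<pi> \<Longrightarrow>
        ef_equiv k (piece c V i) E (piece c' V' j) E' (P \<inter> piece c V i \<times> piece c' V' j)"
    and unmatched: "i \<in> I - Domain \<pi> \<Longrightarrow> j \<in> J - Range \<pi> \<Longrightarrow>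
        ef_equiv k (piece c V i) E (piece c' V' j) E' {}"
    and reserve: "k \<le> card (I - Domain \<pi>)" "k \<le> card (J - Range \<pi>)"

lemma glued_converse:
  assumes "glued k c I V E c' J V' E' \<pi> P"
  shows "glued k c' J V' E' c I V E (\<pi>\<inverse>) (P\<inverse>)"
proof -
  interpret glued k c I V E c' J V' E' \<pi> P by fact
  have conv: "P\<inverse> \<inter> piece c' V' j \<times> piece c V i = (P \<inter> piece c V i \<times> piece c' V' j)\<inverse>" for i j
    by auto
  show ?thesis
  proof
    show "ef_equiv k (piece c' V' j) E' (piece c V i) E (P\<inverse> \<inter> piece c' V' j \<times> piece c V i)"
      if "(j, i) \<in> \<pi>\<inverse>" for j i
      unfolding conv using that matched by (intro ef_equiv_converse) simp
    show "ef_equiv k (piece c' V' j) E' (piece c V i) E {}"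
      if "j \<in> J - Domain (\<pi>\<inverse>)" "i \<in> I - Range (\<pi>\<inverse>)" for i j
      using ef_equiv_converse[OF unmatched, of i j] that by simp
    show "j = j' \<longleftrightarrow> i = i'" if "(j, i) \<in> \<pi>\<inverse>" "(j', i') \<in> \<pi>\<inverse>" for i j i' j'
      using matching that by blast
    show "b \<in> V' \<and> a \<in> V \<and> (c' b, c a) \<in> \<pi>\<inverse>" if "(b, a) \<in> P\<inverse>" for a b
      using position that by simp
  qed (use crossing indices reserve in simp_all)
qed

context glued
begin

lemma position_partial_iso: "partial_iso E E' P"
  unfolding partial_iso_def
proof (intro allI impI)
  fix a b a' b' assume ab: "(a, b) \<in> P" "(a', b') \<in> P"
  note pos = position[OF ab(1)] position[OF ab(2)]
  then have iff: "c a = c a' \<longleftrightarrow> c' b = c' b'"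
    using matching by blast
  show "(a = a' \<longleftrightarrow> b = b') \<and> ({a, a'} \<in> E \<longleftrightarrow> {b, b'} \<in> E')"
  proof (cases "c a = c a'")
    case True
    have "partial_iso E E' (P \<inter> piece c V (c a) \<times> piece c' V' (c' b))"
      using pos matched ef_equiv_partial_iso by blast
    moreover have "(a, b) \<in> P \<inter> piece c V (c a) \<times> piece c' V' (c' b)"
      "(a', b') \<in> P \<inter> piece c V (c a) \<times> piece c' V' (c' b)"
      using ab pos True iff by (auto simp: piece_def)
    ultimately show ?thesis
      unfolding partial_iso_def by blast
  next
    case False
    then show ?thesis
      using pos iff crossing unfolding no_crossing_def by metis
  qed
qed

end

text \<open>Spoiler's vertex lies in a matched piece, where the local strategy answers, or opens a new piece,
  which gets matched with any unmatched piece of the other graph.\<close>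

lemma glued_forth:
  assumes "glued (Suc k) c I V E c' J V' E' \<pi> P" and v: "v \<in> V"
  obtains w \<pi>' where "w \<in> V'" "glued k c I V E c' J V' E' \<pi>' (insert (v, w) P)"
proof -
  interpret glued "Suc k" c I V E c' J V' E' \<pi> P by fact
  have vp: "v \<in> piece c V (c v)" using v by (simp add: piece_def)
  have forth: "\<exists>w\<in>piece c' V' j.
      ef_equiv k (piece c V (c v)) E (piece c' V' j) E' (insert (v, w) Q)"
    if "ef_equiv (Suc k) (piece c V (c v)) E (piece c' V' j) E' Q" for j Q
    using that vp by simp
  have other: "ef_equiv k (piece c V i) E (piece c' V' j) E' (insert (v, w) P \<inter> piece c V i \<times> piece c' V' j)"
    if "(i, j) \<in> \<pi>" "i \<noteq> c v" for i j w
  proof -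
    have "insert (v, w) P \<inter> piece c V i \<times> piece c' V' j = P \<inter> piece c V i \<times> piece c' V' j"
      using that(2) by (auto simp: piece_def)
    then show ?thesis using ef_equiv_Suc_imp[OF matched[OF that(1)]] by simp
  qed
  show ?thesis
  proof (cases "c v \<in> Domain \<pi>")
    case True
    then obtain j where j: "(c v, j) \<in> \<pi>" by blast
    from forth[OF matched[OF j]] obtain w where w: "w \<in> piece c' V' j"
      "ef_equiv k (piece c V (c v)) E (piece c' V' j) E'
         (insert (v, w) (P \<inter> piece c V (c v) \<times> piece c' V' j))"
      by blast
    have "glued k c I V E c' J V' E' \<pi> (insert (v, w) P)"
    proof
      show "ef_equiv k (piece c V i) E (piece c' V' j') E' (insert (v, w) P \<inter> piece c V i \<times> piece c' V' j')"
        if ij: "(i, j') \<in> \<pi>" for i j'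
      proof (cases "i = c v")
        case True
        then have "j' = j" using matching that j by blast
        have "insert (v, w) P \<inter> piece c V i \<times> piece c' V' j' =
            insert (v, w) (P \<inter> piece c V (c v) \<times> piece c' V' j)"
          using True \<open>j' = j\<close> w(1) vp by auto
        then show ?thesis using w True \<open>j' = j\<close> by simp
      qed (use other ij in blast)
      show "a \<in> V \<and> b \<in> V' \<and> (c a, c' b) \<in> \<pi>" if "(a, b) \<in> insert (v, w) P" for a b
        using that position w(1) v j by (auto simp: piece_def)
      show "i1 = i2 \<longleftrightarrow> j1 = j2" if "(i1, j1) \<in> \<pi>" "(i2, j2) \<in> \<pi>" for i1 j1 i2 j2
        using that matching by blast
      show "ef_equiv k (piece c V i) E (piece c' V' j) E' {}"
        if "i \<in> I - Domain \<pi>" "j \<in> J - Range \<pi>" for i j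
        using ef_equiv_Suc_imp[OF unmatched] that by blast
    qed (use crossing indices reserve in simp_all)
    then show ?thesis using that w(1) by (auto simp: piece_def)
  next
    case False
    have "card (J - Range \<pi>) > 0" using reserve by linarith
    then obtain j where j: "j \<in> J - Range \<pi>" by (metis card_gt_0_iff ex_in_conv)
    have i: "c v \<in> I - Domain \<pi>" using False indices v by blast
    from forth[OF unmatched[OF i j]] obtain w where w: "w \<in> piece c' V' j"
      "ef_equiv k (piece c V (c v)) E (piece c' V' j) E' {(v, w)}"
      by auto
    define \<pi>' where "\<pi>' = insert (c v, j) \<pi>"
    have rest: "I - Domain \<pi>' = (I - Domain \<pi>) - {c v}" "J - Range \<pi>' = (J - Range \<pi>) - {j}"
      by (auto simp: \<pi>'_def)
    have "glued k c I V E c' J V' E' \<pi>' (insert (v, w) P)"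
    proof
      show "k \<le> card (I - Domain \<pi>')" "k \<le> card (J - Range \<pi>')"
        unfolding rest using reserve i j indices by simp_all
      show "ef_equiv k (piece c V i) E (piece c' V' j') E' (insert (v, w) P \<inter> piece c V i \<times> piece c' V' j')"
        if "(i, j') \<in> \<pi>'" for i j'
      proof (cases "(i, j') = (c v, j)")
        case True
        have "P \<inter> piece c V (c v) \<times> piece c' V' j = {}"
          using position False by (fastforce simp: piece_def)
        then have "insert (v, w) P \<inter> piece c V i \<times> piece c' V' j' = {(v, w)}"
          using True w(1) vp by auto
        then show ?thesis using w True by simp
      next
        case neq: False
        then have "(i, j') \<in> \<pi>" using that by (auto simp: \<pi>'_def)
        then show ?thesis using other False by blast
      qed
      show "a \<in> V \<and> b \<in> V' \<and> (c a, c' b) \<in> \<pi>'" if "(a, b) \<in> insert (v, w) P" for a b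
        using that position w(1) v by (auto simp: piece_def \<pi>'_def)
      show "i1 = i2 \<longleftrightarrow> j1 = j2" if "(i1, j1) \<in> \<pi>'" "(i2, j2) \<in> \<pi>'" for i1 j1 i2 j2
        using that matching i j unfolding \<pi>'_def by blast
      show "ef_equiv k (piece c V i) E (piece c' V' j) E' {}"
        if "i \<in> I - Domain \<pi>'" "j \<in> J - Range \<pi>'" for i j
        using ef_equiv_Suc_imp[OF unmatched] that unfolding rest by blast
    qed (use crossing indices in simp_all)
    then show ?thesis using that w(1) by (auto simp: piece_def)
  qed
qed

lemma glued_ef_equiv:
  "glued k c I V E c' J V' E' \<pi> P \<Longrightarrow> ef_equiv k V E V' E' P"
proof (induction k arbitrary: \<pi> P)
  case 0
  then show ?case using glued.position_partial_iso by fastforce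
next
  case (Suc k)
  have "\<exists>w\<in>V'. ef_equiv k V E V' E' (insert (v, w) P)" if "v \<in> V" for v
    using glued_forth[OF Suc.prems that] Suc.IH by metis
  moreover have "\<exists>v\<in>V. ef_equiv k V E V' E' (insert (v, w) P)" if "w \<in> V'" for w
  proof -
    from glued_forth[OF glued_converse[OF Suc.prems] that] obtain v \<pi>' where
      v: "v \<in> V" "glued k c' J V' E' c I V E \<pi>' (insert (w, v) (P\<inverse>))" by metis
    have "(insert (w, v) (P\<inverse>))\<inverse> = insert (v, w) P" by auto
    then have "glued k c I V E c' J V' E' (\<pi>'\<inverse>) (insert (v, w) P)"
      using glued_converse[OF v(2)] by simp
    then show ?thesis using v(1) Suc.IH by blast
  qed
  ultimately show ?case using glued.position_partial_iso[OF Suc.prems] by simp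
qed

section \<open>Absorption of a disjoint summand\<close>

definition sum_edges :: "'a set set \<Rightarrow> 'b set set \<Rightarrow> ('a + 'b) set set" where
  "sum_edges E F = (image Inl) ` E \<union> (image Inr) ` F"

lemma sum_edges_iff [simp]:
  "{Inl x, Inl y} \<in> sum_edges E F \<longleftrightarrow> {x, y} \<in> E"
  "{Inr u, Inr w} \<in> sum_edges E F \<longleftrightarrow> {u, w} \<in> F"
  "{Inl x, Inr w} \<notin> sum_edges E F"
  "{Inr w, Inl x} \<notin> sum_edges E F"
proof -
  have *: "{Inl x, Inl y} = Inl ` {x, y}" "{Inr u, Inr w} = Inr ` {u, w}" for x y :: 'a and u w :: 'b
    by auto
  show "{Inl x, Inl y} \<in> sum_edges E F \<longleftrightarrow> {x, y} \<in> E"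
    unfolding sum_edges_def * by (auto simp del: image_insert simp: inj_image_eq_iff)
  show "{Inr u, Inr w} \<in> sum_edges E F \<longleftrightarrow> {u, w} \<in> F"
    unfolding sum_edges_def * by (auto simp del: image_insert simp: inj_image_eq_iff)
  show "{Inl x, Inr w} \<notin> sum_edges E F" "{Inr w, Inl x} \<notin> sum_edges E F"
    unfolding sum_edges_def by (auto simp: set_eq_iff)
qed

text \<open>If \<open>V\<close> contains \<open>k\<close> isolated pieces equivalent to \<open>W\<close>, then a further disjoint copy of
  \<open>W\<close> cannot be noticed in \<open>k\<close> rounds. The pieces \<open>1, \<dots>, k\<close> are the copies. Piece \<open>0\<close> is the
  rest of \<open>V\<close>, matched with itself at the start, and piece \<open>k + 1\<close> is the new summand \<open>W\<close>.\<close>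

lemma ef_equiv_absorb:
  fixes V :: "'a set" and W :: "'b set" and c :: "'a \<Rightarrow> nat"
  assumes crossing: "no_crossing c V E" and range: "c ` V \<subseteq> {..k}"
    and copies: "\<And>i. i \<in> {1..k} \<Longrightarrow> ef_equiv k (piece c V i) E W F {}"
  shows "ef_equiv k V E (V <+> W) (sum_edges E F) {}"
proof -
  define c' :: "'a + 'b \<Rightarrow> nat" where "c' = case_sum c (\<lambda>_. Suc k)"
  have inl: "piece c' (V <+> W) i = Inl ` piece c V i" if "i \<le> k" for i
    using that by (auto simp: piece_def c'_def)
  have inr: "piece c' (V <+> W) (Suc k) = Inr ` W"
    using range by (auto simp: piece_def c'_def)
  have iso_inl: "ef_equiv k (piece c V i) E (piece c' (V <+> W) i) (sum_edges E F) {}"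
    if "i \<le> k" for i
    using that by (intro ef_equiv_graph_iso[where h = Inl]) (auto simp: inl bij_betw_def)
  have to_W: "ef_equiv k W F (piece c' (V <+> W) j) (sum_edges E F) {}" if "j \<in> {1..Suc k}" for j
  proof (cases "j = Suc k")
    case True
    have "ef_equiv k W F (Inr ` W) (sum_edges E F) {}"
      by (intro ef_equiv_graph_iso[where h = Inr]) (auto simp: bij_betw_def)
    then show ?thesis by (simp add: True inr)
  next
    case False
    then have "ef_equiv k W F (piece c V j) E {}" "j \<le> k"
      using that ef_equiv_converse[OF copies[of j]] by auto
    then show ?thesis using ef_equiv_trans[OF _ iso_inl] by blast
  qed
  have "glued k c {..k} V E c' {..Suc k} (V <+> W) (sum_edges E F) {(0, 0)} {}"
  proof
    show "no_crossing c' (V <+> W) (sum_edges E F)"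
      using crossing by (auto simp: no_crossing_def c'_def)
    show "c' ` (V <+> W) \<subseteq> {..Suc k}"
      using range by (auto simp: c'_def)
    show "ef_equiv k (piece c V i) E (piece c' (V <+> W) j) (sum_edges E F)
        ({} \<inter> piece c V i \<times> piece c' (V <+> W) j)" if "(i, j) \<in> {(0, 0)}" for i j
      using that iso_inl[of 0] by simp
    show "ef_equiv k (piece c V i) E (piece c' (V <+> W) j) (sum_edges E F) {}"
      if "i \<in> {..k} - Domain {(0, 0)}" "j \<in> {..Suc k} - Range {(0, 0)}" for i j
    proof (rule ef_equiv_trans)
      show "ef_equiv k (piece c V i) E W F {}" using that by (intro copies) auto
      show "ef_equiv k W F (piece c' (V <+> W) j) (sum_edges E F) {}" using that by (intro to_W) auto
    qed simp
  qed (use crossing range in auto)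
  then show ?thesis by (rule glued_ef_equiv)
qed

text \<open>Both graphs are equivalent to their disjoint union.\<close>

lemma ef_equiv_mutual_absorb:
  fixes V :: "'a set" and W :: "'b set" and c :: "'a \<Rightarrow> nat" and d :: "'b \<Rightarrow> nat"
  assumes "no_crossing c V E" "c ` V \<subseteq> {..k}"
    and "\<And>i. i \<in> {1..k} \<Longrightarrow> ef_equiv k (piece c V i) E W F {}"
    and "no_crossing d W F" "d ` W \<subseteq> {..k}"
    and "\<And>i. i \<in> {1..k} \<Longrightarrow> ef_equiv k (piece d W i) F V E {}"
  shows "ef_equiv k V E W F {}"
proof -
  have 1: "ef_equiv k V E (V <+> W) (sum_edges E F) {}"
    using assms(1-3) by (rule ef_equiv_absorb)
  have 2: "ef_equiv k (V <+> W) (sum_edges E F) (W <+> V) (sum_edges F E) {}"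
    by (intro ef_equiv_graph_iso[where h = "case_sum Inr Inl"])
       (auto intro!: bij_betwI[where g = "case_sum Inr Inl"])
  have 3: "ef_equiv k (W <+> V) (sum_edges F E) W F {}"
    using ef_equiv_converse[OF ef_equiv_absorb[OF assms(4-6)]] by simp
  show ?thesis
    using ef_equiv_trans[OF ef_equiv_trans[OF 1 2, of "{}"] 3] by simp
qed

section \<open>Isolated copies inside an interval of vertices\<close>

definition shift_edges :: "nat \<Rightarrow> nat set set \<Rightarrow> nat set set" where
  "shift_edges s F = (image (\<lambda>v. v + s)) ` F"

text \<open>The edges of \<open>k\<close> copies, side by side, of a graph on \<open>{1..m}\<close>. Only translations are involved, so
  all edges keep their lengths and a graph of positive probability gives one of positive
  probability. Looking for a single isolated stack replaces looking for \<open>k\<close> disjoint isolated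
  copies.\<close>

definition stack :: "nat \<Rightarrow> nat \<Rightarrow> nat set set \<Rightarrow> nat set set" where
  "stack k m F = (\<Union>i<k. shift_edges (i * m) F)"

definition isolated_copy :: "nat \<Rightarrow> nat set set \<Rightarrow> nat \<Rightarrow> nat \<Rightarrow> nat set set \<Rightarrow> bool" where
  "isolated_copy n E s m F \<longleftrightarrow> s + m \<le> n \<and>
     (\<forall>e\<in>vertex_pairs n. e \<inter> {s + 1..s + m} \<noteq> {} \<longrightarrow> (e \<in> E \<longleftrightarrow> e \<in> shift_edges s F))"

lemma shift_edges_iff [simp]: "(\<lambda>v. v + s) ` e \<in> shift_edges s F \<longleftrightarrow> e \<in> F"
proof -
  have "inj (\<lambda>v::nat. v + s)" by (simp add: inj_on_def)
  then show ?thesis by (auto simp: shift_edges_def inj_image_eq_iff)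
qed

lemma shift_edges_vertex_pairs:
  assumes "F \<subseteq> vertex_pairs m" "s + m \<le> n"
  shows "shift_edges s F \<subseteq> vertex_pairs n"
  using assms by (fastforce simp: shift_edges_def vertex_pairs_def card_image)

lemma stack_vertex_pairs:
  assumes "F \<subseteq> vertex_pairs m"
  shows "stack k m F \<subseteq> vertex_pairs (k * m)"
proof -
  have "shift_edges (i * m) F \<subseteq> vertex_pairs (k * m)" if "i < k" for i
  proof (rule shift_edges_vertex_pairs[OF assms])
    have "Suc i * m \<le> k * m" using that by (intro mult_right_mono) auto
    then show "i * m + m \<le> k * m" by simp
  qed
  then show ?thesis by (auto simp: stack_def)
qed

lemma block_index:
  fixes u m :: nat
  assumes "1 \<le> u" "u \<le> m"
  shows "(u + i * m - 1) div m = i"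
proof -
  have "(u + i * m - 1) div m = ((u - 1) + i * m) div m" using assms by simp
  also have "\<dots> = i + (u - 1) div m" using assms by (intro div_mult_self1) auto
  also have "(u - 1) div m = 0" using assms by auto
  finally show ?thesis by simp
qed

lemma shift_stack_iff:
  assumes F: "F \<subseteq> vertex_pairs m" and i: "i < k" and e: "e \<noteq> {}" "e \<subseteq> {1..m}"
  shows "(\<lambda>v. v + (i * m + s)) ` e \<in> shift_edges s (stack k m F) \<longleftrightarrow> e \<in> F"
proof
  assume "(\<lambda>v. v + (i * m + s)) ` e \<in> shift_edges s (stack k m F)"
  moreover have "(\<lambda>v. v + (i * m + s)) ` e = (\<lambda>v. v + s) ` ((\<lambda>v. v + i * m) ` e)"
    by (simp add: image_image add.assoc)
  ultimately have "(\<lambda>v. v + i * m) ` e \<in> stack k m F" by simp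
  then obtain j where j: "(\<lambda>v. v + i * m) ` e \<in> shift_edges (j * m) F"
    by (auto simp: stack_def)
  then obtain f where f: "f \<in> F" "(\<lambda>v. v + i * m) ` e = (\<lambda>v. v + j * m) ` f"
    by (auto simp: shift_edges_def)
  from e obtain u where u: "u \<in> e" "1 \<le> u" "u \<le> m" by fastforce
  then obtain w where w: "w \<in> f" "u + i * m = w + j * m"
    using f(2) by (metis (no_types, lifting) imageE imageI)
  have "f \<subseteq> {1..m}" using F f(1) by (auto simp: vertex_pairs_def)
  then have "1 \<le> w" "w \<le> m" using w by auto
  then have "i = j" using w u block_index by metis
  then show "e \<in> F" using j by simp
next
  assume "e \<in> F"
  then have "(\<lambda>v. v + s) ` ((\<lambda>v. v + i * m) ` e) \<in> shift_edges s (stack k m F)"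
    using i unfolding shift_edges_iff stack_def by (intro UN_I[of i]) simp_all
  then show "(\<lambda>v. v + (i * m + s)) ` e \<in> shift_edges s (stack k m F)"
    by (simp add: image_image add.assoc)
qed

text \<open>The layers of an isolated stack are the pieces \<open>1, \<dots>, k\<close>; all vertices outside the stack form
  piece \<open>0\<close>.\<close>

lemma isolated_stack_pieces:
  assumes F: "F \<subseteq> vertex_pairs m" and E: "E \<subseteq> vertex_pairs n"
    and copy: "isolated_copy n E s (k * m) (stack k m F)"
  shows "\<exists>c. no_crossing c {1..n} E \<and> c ` {1..n} \<subseteq> {..k} \<and>
    (\<forall>i\<in>{1..k}. \<forall>l. ef_equiv l (piece c {1..n} i) E {1..m} F {})"
proof -
  define c where "c v = (if v \<in> {s + 1..s + k * m} then Suc ((v - s - 1) div m) else 0)" for v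
  have le: "s + k * m \<le> n" using copy by (simp add: isolated_copy_def)
  have copyD: "e \<in> E \<longleftrightarrow> e \<in> shift_edges s (stack k m F)"
    if "e \<in> vertex_pairs n" "e \<inter> {s + 1..s + k * m} \<noteq> {}" for e
    using copy that by (simp add: isolated_copy_def)
  have c_eq: "c (u + (i * m + s)) = Suc i" if "i < k" "u \<in> {1..m}" for i u
  proof -
    have "Suc i * m \<le> k * m" using that by (intro mult_right_mono) auto
    then have "u + (i * m + s) \<in> {s + 1..s + k * m}" using that by auto
    moreover have "(u + (i * m + s) - s - 1) div m = i"
      using block_index[of u m i] that by simp
    ultimately show ?thesis by (simp add: c_def)
  qed
  have c_le: "c v \<le> k" for v
  proof (cases "v \<in> {s + 1..s + k * m}")
    case True
    then have "v - s - 1 < k * m" by auto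
    then have "(v - s - 1) div m < k" by (simp add: less_mult_imp_div_less)
    then show ?thesis using True by (simp add: c_def)
  qed (auto simp: c_def)
  have c_inv: "\<exists>u\<in>{1..m}. v = u + (i * m + s)" if "c v = Suc i" for v i
  proof -
    from that have v: "v \<in> {s + 1..s + k * m}" and i: "i = (v - s - 1) div m"
      by (auto simp: c_def split: if_splits)
    have "m > 0" using v by (cases m) auto
    have "v = Suc ((v - s - 1) mod m) + (i * m + s)"
      using v div_mult_mod_eq[of "v - s - 1" m] unfolding i by auto
    moreover have "Suc ((v - s - 1) mod m) \<in> {1..m}"
      using \<open>m > 0\<close> by (simp add: Suc_leI)
    ultimately show ?thesis by blast
  qed
  have edge_c: "c x = c y" if "{x, y} \<in> E" "c x \<noteq> 0" for x y
  proof -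
    from that(2) have "x \<in> {s + 1..s + k * m}" by (auto simp: c_def split: if_splits)
    then have "{x, y} \<in> shift_edges s (stack k m F)"
      using that(1) copyD[of "{x, y}"] E by auto
    then obtain i f where i: "i < k" "f \<in> F" "{x, y} = (\<lambda>v. v + (i * m + s)) ` f"
      by (auto simp: shift_edges_def stack_def image_image add.assoc)
    then have "f \<subseteq> {1..m}" using F by (auto simp: vertex_pairs_def)
    then have "\<forall>z\<in>{x, y}. c z = Suc i"
      unfolding i(3) using c_eq[OF i(1)] by blast
    then show ?thesis by simp
  qed
  have range: "c ` {1..n} \<subseteq> {..k}" using c_le by auto
  have crossing: "no_crossing c {1..n} E"
    unfolding no_crossing_def using edge_c by (metis insert_commute)
  have pieces: "ef_equiv l (piece c {1..n} i') E {1..m} F {}" if "i' \<in> {1..k}" for i' l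
  proof -
    from that obtain i where i: "i' = Suc i" "i < k" by (cases i') auto
    define h where "h = (\<lambda>u. u + (i * m + s))"
    have "Suc i * m \<le> k * m" using i by (intro mult_right_mono) auto
    then have h_le: "h u \<in> {1..n}" if "u \<in> {1..m}" for u
      using that le by (auto simp: h_def)
    have piece: "piece c {1..n} i' = h ` {1..m}"
    proof
      show "piece c {1..n} i' \<subseteq> h ` {1..m}"
      proof
        fix x assume "x \<in> piece c {1..n} i'"
        then have "c x = Suc i" by (simp add: piece_def i(1))
        then obtain u where "u \<in> {1..m}" "x = h u" using c_inv unfolding h_def by blast
        then show "x \<in> h ` {1..m}" by blast
      qed
      show "h ` {1..m} \<subseteq> piece c {1..n} i'"
      proof
        fix x assume "x \<in> h ` {1..m}"
        then obtain u where u: "u \<in> {1..m}" "x = h u" by blast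
        then show "x \<in> piece c {1..n} i'"
          using c_eq[OF i(2) u(1)] h_le[OF u(1)] unfolding piece_def i(1) h_def by simp
      qed
    qed
    have "ef_equiv l {1..m} F (h ` {1..m}) E {}"
    proof (rule ef_equiv_graph_iso)
      show "bij_betw h {1..m} (h ` {1..m})" by (simp add: bij_betw_def inj_on_def h_def)
      fix x y assume xy: "x \<in> {1..m}" "y \<in> {1..m}"
      show "{x, y} \<in> F \<longleftrightarrow> {h x, h y} \<in> E"
      proof (cases "x = y")
        case True
        then have "{x, y} \<notin> F" "{h x, h y} \<notin> E" using F E by (auto simp: vertex_pairs_def)
        then show ?thesis by simp
      next
        case False
        then have "{h x, h y} \<in> vertex_pairs n"
          using h_le[OF xy(1)] h_le[OF xy(2)] by (auto simp: vertex_pairs_def h_def)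
        moreover have "h x \<in> {s + 1..s + k * m}"
          using \<open>Suc i * m \<le> k * m\<close> xy by (auto simp: h_def)
        ultimately have "{h x, h y} \<in> E \<longleftrightarrow> {h x, h y} \<in> shift_edges s (stack k m F)"
          using copyD[of "{h x, h y}"] by blast
        also have "{h x, h y} = (\<lambda>v. v + (i * m + s)) ` {x, y}" by (simp add: h_def)
        also have "\<dots> \<in> shift_edges s (stack k m F) \<longleftrightarrow> {x, y} \<in> F"
          using xy by (intro shift_stack_iff F i) auto
        finally show ?thesis by (simp add: h_def)
      qed
    qed simp
    from ef_equiv_converse[OF this] show ?thesis unfolding piece by simp
  qed
  show ?thesis
    by (intro exI[of _ c] conjI ballI allI crossing range pieces)
qed

section \<open>Independence and conflict-free subfamilies\<close>

text \<open>Independence of the events ``the outcome agrees with the pattern \<open>x\<close> on the block \<open>B t\<close>'' for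
  disjoint blocks, in the form needed: none of them occurs. Prescribing the outcome on a further
  set \<open>C\<close> lets the induction run on the blocks, since the event that block \<open>t\<close> fails to match is
  a difference of two events of the same form, with \<open>C\<close> and with \<open>C \<union> B t\<close>.\<close>

lemma prob_no_block_matches:
  assumes A: "finite A" and T: "finite T"
    and B: "\<And>t. t \<in> T \<Longrightarrow> B t \<subseteq> A" and disj: "disjoint_family_on B T"
    and C: "C \<subseteq> A" "\<And>t. t \<in> T \<Longrightarrow> B t \<inter> C = {}"
  shows "measure_pmf.prob (Pi_pmf A d P) {X. (\<forall>e\<in>C. X e = x e) \<and> (\<forall>t\<in>T. \<exists>e\<in>B t. X e \<noteq> x e)} =
    (\<Prod>e\<in>C. pmf (P e) (x e)) * (\<Prod>t\<in>T. 1 - (\<Prod>e\<in>B t. pmf (P e) (x e)))"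
  using T B disj C
proof (induction T arbitrary: C rule: finite_induct)
  case empty
  have "{X. \<forall>e\<in>C. X e = x e} = Pi A (\<lambda>e. if e \<in> C then {x e} else UNIV)"
    using empty.prems by (auto simp: Pi_def split: if_splits)
  moreover have "(\<Prod>e\<in>A. measure_pmf.prob (P e) (if e \<in> C then {x e} else UNIV)) =
      (\<Prod>e\<in>C. pmf (P e) (x e))"
    using empty.prems A by (intro prod.mono_neutral_cong_right) (auto simp: measure_pmf_single)
  ultimately show ?case
    using measure_Pi_pmf_Pi[OF A, of d P "\<lambda>e. if e \<in> C then {x e} else UNIV"] by simp
next
  case (insert t T)
  define M where "M = measure_pmf.prob (Pi_pmf A d P)"
  define Q where "Q = (\<lambda>X. \<forall>t\<in>T. \<exists>e\<in>B t. X e \<noteq> x e)"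
  have disj': "disjoint_family_on B T"
    using insert.prems(2) by (auto simp: disjoint_family_on_def)
  have split: "{X. (\<forall>e\<in>C. X e = x e) \<and> (\<forall>s\<in>insert t T. \<exists>e\<in>B s. X e \<noteq> x e)} =
      {X. (\<forall>e\<in>C. X e = x e) \<and> Q X} - {X. (\<forall>e\<in>C \<union> B t. X e = x e) \<and> Q X}"
    by (auto simp: Q_def)
  have 1: "M {X. (\<forall>e\<in>C. X e = x e) \<and> Q X} =
      (\<Prod>e\<in>C. pmf (P e) (x e)) * (\<Prod>t\<in>T. 1 - (\<Prod>e\<in>B t. pmf (P e) (x e)))"
    unfolding M_def Q_def using insert.prems disj' by (intro insert.IH) auto
  have 2: "M {X. (\<forall>e\<in>C \<union> B t. X e = x e) \<and> Q X} =
      (\<Prod>e\<in>C \<union> B t. pmf (P e) (x e)) * (\<Prod>t\<in>T. 1 - (\<Prod>e\<in>B t. pmf (P e) (x e)))"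
    unfolding M_def Q_def
  proof (intro insert.IH disj')
    fix s assume s: "s \<in> T"
    then have "B s \<inter> B t = {}"
      using insert.prems(2) insert.hyps by (auto simp: disjoint_family_on_def)
    then show "B s \<inter> (C \<union> B t) = {}" using insert.prems(4)[of s] s by auto
  qed (use insert.prems in auto)
  have "finite C" "finite (B t)"
    using insert.prems A by (auto intro: finite_subset)
  then have 3: "(\<Prod>e\<in>C \<union> B t. pmf (P e) (x e)) = (\<Prod>e\<in>C. pmf (P e) (x e)) * (\<Prod>e\<in>B t. pmf (P e) (x e))"
    using insert.prems(4)[of t] by (intro prod.union_disjoint) auto
  have "M {X. (\<forall>e\<in>C. X e = x e) \<and> (\<forall>s\<in>insert t T. \<exists>e\<in>B s. X e \<noteq> x e)} =
      M {X. (\<forall>e\<in>C. X e = x e) \<and> Q X} - M {X. (\<forall>e\<in>C \<union> B t. X e = x e) \<and> Q X}"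
    unfolding split M_def by (intro measure_pmf.finite_measure_Diff) auto
  then show ?case
    unfolding M_def[symmetric] 1 2 3 using insert.hyps by (simp add: algebra_simps)
qed

text \<open>Greedy choice: picking one element discards at most \<open>D + 1\<close> elements.\<close>

lemma large_independent_subset:
  assumes "finite A" and sym: "\<And>s t. conf s t \<Longrightarrow> conf t s"
    and deg: "\<And>t. t \<in> A \<Longrightarrow> card {s \<in> A. conf t s} \<le> D"
  obtains T where "T \<subseteq> A" "card A \<le> Suc D * card T"
    "\<And>s t. s \<in> T \<Longrightarrow> t \<in> T \<Longrightarrow> s \<noteq> t \<Longrightarrow> \<not> conf s t"
proof -
  have "\<exists>T\<subseteq>A. card A \<le> Suc D * card T \<and> (\<forall>s\<in>T. \<forall>t\<in>T. s \<noteq> t \<longrightarrow> \<not> conf s t)"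
    using \<open>finite A\<close> deg
  proof (induction A rule: finite_psubset_induct)
    case (psubset A)
    show ?case
    proof (cases "A = {}")
      case False
      then obtain t where t: "t \<in> A" by blast
      define A' where "A' = A - insert t {s \<in> A. conf t s}"
      have "A' \<subset> A" using t by (auto simp: A'_def)
      moreover have "card {s \<in> A'. conf u s} \<le> D" if "u \<in> A'" for u
      proof -
        have "card {s \<in> A'. conf u s} \<le> card {s \<in> A. conf u s}"
          using psubset.hyps by (intro card_mono) (auto simp: A'_def)
        then show ?thesis using psubset.prems[of u] that by (auto simp: A'_def)
      qed
      ultimately obtain T where T: "T \<subseteq> A'" "card A' \<le> Suc D * card T"
        "\<forall>s\<in>T. \<forall>t\<in>T. s \<noteq> t \<longrightarrow> \<not> conf s t"
        using psubset.IH[of A'] by blast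
      have "finite T" "t \<notin> T"
        using T(1) psubset.hyps finite_subset by (auto simp: A'_def)
      have "card A \<le> card (A' \<union> insert t {s \<in> A. conf t s})"
        using psubset.hyps by (intro card_mono) (auto simp: A'_def)
      also have "\<dots> \<le> card A' + card (insert t {s \<in> A. conf t s})"
        by (rule card_Un_le)
      also have "card (insert t {s \<in> A. conf t s}) \<le> Suc D"
        using psubset.prems[OF t] psubset.hyps by (simp add: card_insert_if)
      finally have "card A \<le> Suc D * card (insert t T)"
        using T(2) \<open>finite T\<close> \<open>t \<notin> T\<close> by simp
      moreover have "\<not> conf t s" "\<not> conf s t" if "s \<in> T" for s
        using that T(1) sym by (auto simp: A'_def)
      ultimately show ?thesis
        using T t by (intro exI[of _ "insert t T"]) (auto simp: A'_def)
    qed simp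
  qed
  then show ?thesis using that by blast
qed

section \<open>Graphs of positive probability\<close>

definition edge_prob :: "(nat \<Rightarrow> real) \<Rightarrow> nat set \<Rightarrow> real" where
  "edge_prob p e = p (Max e - Min e)"

definition possible :: "(nat \<Rightarrow> real) \<Rightarrow> nat \<Rightarrow> nat set set \<Rightarrow> bool" where
  "possible p n E \<longleftrightarrow> E \<subseteq> vertex_pairs n \<and> (\<forall>e\<in>E. edge_prob p e > 0)"

text \<open>The probability that the pair \<open>e\<close> is an edge exactly if it belongs to \<open>F\<close>.\<close>

definition agree_prob :: "(nat \<Rightarrow> real) \<Rightarrow> nat set set \<Rightarrow> nat set \<Rightarrow> real" where
  "agree_prob p F e = (if e \<in> F then edge_prob p e else 1 - edge_prob p e)"

lemma finite_vertex_pairs [simp]: "finite (vertex_pairs n)"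
  by (rule finite_subset[of _ "Pow {1..n}"]) (auto simp: vertex_pairs_def)

lemma vertex_pairs_D:
  assumes "e \<in> vertex_pairs n"
  obtains v w where "e = {v, w}" "1 \<le> v" "v < w" "w \<le> n" "edge_prob p e = p (w - v)"
proof -
  from assms obtain x y where xy: "e = {x, y}" "x \<noteq> y" "e \<subseteq> {1..n}"
    by (auto simp: vertex_pairs_def card_2_iff)
  define v w where "v = min x y" and "w = max x y"
  have "e = {v, w}" "v < w" using xy by (auto simp: v_def w_def min_def max_def)
  moreover from this have "edge_prob p e = p (w - v)" by (simp add: edge_prob_def)
  ultimately show ?thesis using that[of v w] xy(3) by auto
qed

lemma vertex_pairs_I: "1 \<le> v \<Longrightarrow> v < w \<Longrightarrow> w \<le> n \<Longrightarrow> {v, w} \<in> vertex_pairs n"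
  by (simp add: vertex_pairs_def)

lemma edge_prob_pair: "v < w \<Longrightarrow> edge_prob p {v, w} = p (w - v)"
  by (simp add: edge_prob_def)

lemma edge_prob_shift:
  assumes "e \<in> vertex_pairs n"
  shows "edge_prob p ((\<lambda>v. v + s) ` e) = edge_prob p e"
  using assms by (rule vertex_pairs_D[of _ _ p]) (simp add: edge_prob_def)

lemma possible_shift:
  assumes "possible p m F" "s + m \<le> n"
  shows "possible p n (shift_edges s F)"
  unfolding possible_def
proof
  show "shift_edges s F \<subseteq> vertex_pairs n"
    using assms by (intro shift_edges_vertex_pairs) (auto simp: possible_def)
  show "\<forall>e\<in>shift_edges s F. edge_prob p e > 0"
    using assms by (auto simp: shift_edges_def possible_def subset_iff edge_prob_shift)
qed

lemma possible_stack:
  assumes "possible p m F"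
  shows "possible p (k * m) (stack k m F)"
proof -
  have "possible p (k * m) (shift_edges (i * m) F)" if "i < k" for i
  proof (rule possible_shift[OF assms])
    have "Suc i * m \<le> k * m" using that by (intro mult_right_mono) auto
    then show "i * m + m \<le> k * m" by simp
  qed
  then show ?thesis by (auto simp: possible_def stack_def)
qed

section \<open>The probability of an isolated copy\<close>

lemma prod_subset_ge:
  fixes f :: "'a \<Rightarrow> real"
  assumes "finite B" "A \<subseteq> B" "\<And>x. x \<in> B \<Longrightarrow> 0 \<le> f x \<and> f x \<le> 1"
  shows "(\<Prod>x\<in>B. f x) \<le> (\<Prod>x\<in>A. f x)"
proof -
  have "(\<Prod>x\<in>B. f x) = (\<Prod>x\<in>B - A. f x) * (\<Prod>x\<in>A. f x)"
    using assms by (intro prod.subset_diff)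
  also have "\<dots> \<le> 1 * (\<Prod>x\<in>A. f x)"
    using assms by (intro mult_right_mono prod_le_1 prod_nonneg) auto
  finally show ?thesis by simp
qed

lemma prod_Un_ge:
  fixes f :: "'a \<Rightarrow> real"
  assumes "finite A" "finite B" "\<And>x. x \<in> A \<union> B \<Longrightarrow> 0 \<le> f x \<and> f x \<le> 1"
  shows "(\<Prod>x\<in>A. f x) * (\<Prod>x\<in>B. f x) \<le> (\<Prod>x\<in>A \<union> B. f x)"
proof -
  have "(\<Prod>x\<in>A. f x) * (\<Prod>x\<in>B. f x) \<le> (\<Prod>x\<in>A. f x) * (\<Prod>x\<in>B - A. f x)"
    using assms by (intro mult_left_mono prod_subset_ge prod_nonneg) auto
  also have "\<dots> = (\<Prod>x\<in>A \<union> (B - A). f x)"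
    using assms by (intro prod.union_disjoint[symmetric]) auto
  finally show ?thesis by simp
qed

lemma prod_UN_ge:
  fixes f :: "'a \<Rightarrow> real"
  assumes "finite I" "\<And>i. i \<in> I \<Longrightarrow> finite (S i)"
    and "\<And>i x. i \<in> I \<Longrightarrow> x \<in> S i \<Longrightarrow> 0 \<le> f x \<and> f x \<le> 1"
  shows "(\<Prod>i\<in>I. \<Prod>x\<in>S i. f x) \<le> (\<Prod>x\<in>(\<Union>i\<in>I. S i). f x)"
  using assms
proof (induction I rule: finite_induct)
  case (insert i I)
  have "(\<Prod>i\<in>insert i I. \<Prod>x\<in>S i. f x) = (\<Prod>x\<in>S i. f x) * (\<Prod>i\<in>I. \<Prod>x\<in>S i. f x)"
    using insert.hyps by simp
  also have "\<dots> \<le> (\<Prod>x\<in>S i. f x) * (\<Prod>x\<in>(\<Union>i\<in>I. S i). f x)"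
    using insert.prems insert.IH by (intro mult_left_mono prod_nonneg) auto
  also have "\<dots> \<le> (\<Prod>x\<in>S i \<union> (\<Union>i\<in>I. S i). f x)"
    using insert.prems insert.hyps by (intro prod_Un_ge) auto
  finally show ?case by simp
qed simp

locale edge_probabilities =
  fixes p :: "nat \<Rightarrow> real"
  assumes p_nonneg: "d \<ge> 1 \<Longrightarrow> 0 \<le> p d" and p_less_1: "d \<ge> 1 \<Longrightarrow> p d < 1"
begin

text \<open>A vertex of \<open>{1..n}\<close> has at most one pair of each length \<open>d < n\<close> on either side; so the
  probability that it has no neighbour is at least the square of this product.\<close>

definition isolation :: "nat \<Rightarrow> real" where
  "isolation n = (\<Prod>d\<in>{1..<n}. 1 - p d)"

definition num_distances :: "nat \<Rightarrow> nat" where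
  "num_distances n = card {d \<in> {1..<n}. p d > 0}"

lemma edge_prob_bounds:
  assumes "e \<in> vertex_pairs n"
  shows "0 \<le> edge_prob p e" "edge_prob p e < 1"
  using assms by (rule vertex_pairs_D[of _ _ p]; use p_nonneg p_less_1 in simp)+

lemma isolation_nonneg: "0 \<le> isolation n"
  unfolding isolation_def using p_less_1 by (intro prod_nonneg) (auto simp: less_imp_le)

lemma isolation_le: "D \<subseteq> {1..<n} \<Longrightarrow> isolation n \<le> (\<Prod>d\<in>D. 1 - p d)"
  unfolding isolation_def using p_nonneg p_less_1
  by (intro prod_subset_ge) (auto simp: less_imp_le)

lemma agree_prob_pos:
  assumes "possible p m F"
  shows "0 < (\<Prod>e\<in>vertex_pairs m. agree_prob p F e)"
  using assms edge_prob_bounds by (intro prod_pos) (auto simp: agree_prob_def possible_def)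

lemma prod_star_ge:
  assumes "v \<in> {1..n}"
  shows "isolation n ^ 2 \<le> (\<Prod>e\<in>{e \<in> vertex_pairs n. v \<in> e}. 1 - edge_prob p e)"
proof -
  define up where "up = (\<lambda>d. {v, v + d}) ` {1..n - v}"
  define down where "down = (\<lambda>d. {v - d, v}) ` {1..<v}"
  have up: "(\<Prod>e\<in>up. 1 - edge_prob p e) = (\<Prod>d\<in>{1..n - v}. 1 - p d)"
    unfolding up_def
    by (subst prod.reindex) (auto simp: inj_on_def doubleton_eq_iff edge_prob_pair)
  have down: "(\<Prod>e\<in>down. 1 - edge_prob p e) = (\<Prod>d\<in>{1..<v}. 1 - p d)"
    unfolding down_def
    by (subst prod.reindex) (auto simp: inj_on_def doubleton_eq_iff edge_prob_pair)
  have sub: "up \<union> down \<subseteq> vertex_pairs n"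
    using assms by (auto simp: up_def down_def intro!: vertex_pairs_I)
  have eq: "{e \<in> vertex_pairs n. v \<in> e} = up \<union> down"
  proof
    show "{e \<in> vertex_pairs n. v \<in> e} \<subseteq> up \<union> down"
    proof
      fix e assume "e \<in> {e \<in> vertex_pairs n. v \<in> e}"
      then have e: "e \<in> vertex_pairs n" "v \<in> e" by auto
      from e(1) obtain x y where xy: "e = {x, y}" "1 \<le> x" "x < y" "y \<le> n"
        by (rule vertex_pairs_D[of _ _ p])
      from e(2) xy(1) consider "v = x" | "v = y" by blast
      then show "e \<in> up \<union> down"
      proof cases
        case 1
        then have "e = {v, v + (y - x)}" "y - x \<in> {1..n - v}" using xy by auto
        then show ?thesis unfolding up_def by blast
      next
        case 2
        then have "e = {v - (y - x), v}" "y - x \<in> {1..<v}" using xy by auto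
        then show ?thesis unfolding down_def by blast
      qed
    qed
    show "up \<union> down \<subseteq> {e \<in> vertex_pairs n. v \<in> e}"
      using sub by (auto simp: up_def down_def)
  qed
  have "isolation n ^ 2 \<le> (\<Prod>e\<in>up. 1 - edge_prob p e) * (\<Prod>e\<in>down. 1 - edge_prob p e)"
    unfolding up down power2_eq_square using assms isolation_nonneg p_less_1
    by (intro mult_mono isolation_le prod_nonneg) (auto simp: less_imp_le)
  also have "\<dots> \<le> (\<Prod>e\<in>up \<union> down. 1 - edge_prob p e)"
  proof (intro prod_Un_ge)
    show "0 \<le> 1 - edge_prob p e \<and> 1 - edge_prob p e \<le> 1" if "e \<in> up \<union> down" for e
      using edge_prob_bounds[of e n] sub that by auto
  qed (auto simp: up_def down_def)
  finally show ?thesis by (simp add: eq)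
qed

text \<open>Pairs inside the block contribute a factor that depends only on \<open>F\<close>, as probabilities are
  translation invariant. The pairs leaving the block have to be non-edges. They are covered by the
  stars of the \<open>m\<close> vertices of the block, and each star contributes a factor of at least
  \<open>isolation n ^ 2\<close>. As all factors are at most \<open>1\<close>, pairs that are counted repeatedly only lower the bound.\<close>

lemma isolated_copy_prob_ge:
  assumes F: "possible p m F" and s: "s + m \<le> n"
  shows "(\<Prod>e\<in>vertex_pairs m. agree_prob p F e) * isolation n ^ (2 * m)
    \<le> (\<Prod>e\<in>{e \<in> vertex_pairs n. e \<inter> {s + 1..s + m} \<noteq> {}}. agree_prob p (shift_edges s F) e)"
proof -
  define Blk where "Blk = {s + 1..s + m}"
  define inside where "inside = (image (\<lambda>v. v + s)) ` vertex_pairs m"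
  define cross where "cross = {e \<in> vertex_pairs n. e \<inter> Blk \<noteq> {} \<and> \<not> e \<subseteq> Blk}"
  have "inj (image (\<lambda>v::nat. v + s))"
    by (auto simp: inj_def inj_image_eq_iff)
  then have inj: "inj_on (image (\<lambda>v::nat. v + s)) S" for S
    by (rule inj_on_subset) simp
  have shift_sub: "e \<subseteq> Blk" if "e \<in> shift_edges s F" for e
  proof -
    from that obtain f where f: "f \<in> F" "e = (\<lambda>v. v + s) ` f"
      by (auto simp: shift_edges_def)
    then have "f \<subseteq> {1..m}" using F by (auto simp: possible_def vertex_pairs_def)
    then show ?thesis using f(2) by (auto simp: Blk_def)
  qed
  have "{e \<in> vertex_pairs n. e \<inter> Blk \<noteq> {}} = inside \<union> cross"
  proof
    show "{e \<in> vertex_pairs n. e \<inter> Blk \<noteq> {}} \<subseteq> inside \<union> cross"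
    proof
      fix e assume e: "e \<in> {e \<in> vertex_pairs n. e \<inter> Blk \<noteq> {}}"
      show "e \<in> inside \<union> cross"
      proof (cases "e \<subseteq> Blk")
        case True
        then have "(\<lambda>v. v - s) ` e \<in> vertex_pairs m" "e = (\<lambda>v. v + s) ` ((\<lambda>v. v - s) ` e)"
        proof -
          have "inj_on (\<lambda>v. v - s) e" using True by (force simp: inj_on_def Blk_def)
          moreover have "v - s \<in> {1..m}" if "v \<in> e" for v
            using that True by (fastforce simp: Blk_def)
          ultimately show "(\<lambda>v. v - s) ` e \<in> vertex_pairs m"
            using e by (auto simp: vertex_pairs_def card_image)
          have "(\<lambda>v. v - s + s) ` e = id ` e"
            using True by (intro image_cong) (auto simp: Blk_def)
          then show "e = (\<lambda>v. v + s) ` ((\<lambda>v. v - s) ` e)" by (simp add: image_image)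
        qed
        then show ?thesis unfolding inside_def by blast
      qed (use e in \<open>auto simp: cross_def\<close>)
    qed
    show "inside \<union> cross \<subseteq> {e \<in> vertex_pairs n. e \<inter> Blk \<noteq> {}}"
    proof -
      have "inside \<subseteq> vertex_pairs n"
        unfolding inside_def using shift_edges_vertex_pairs[of "vertex_pairs m" m s n] s
        by (simp add: shift_edges_def)
      moreover have "e \<inter> Blk \<noteq> {}" if "e \<in> inside" for e
        using that by (force simp: inside_def Blk_def vertex_pairs_def card_2_iff)
      ultimately show ?thesis by (auto simp: cross_def)
    qed
  qed
  moreover have "inside \<inter> cross = {}"
    by (force simp: inside_def cross_def Blk_def vertex_pairs_def)
  moreover have fin: "finite inside" "finite cross"
    by (simp_all add: inside_def cross_def)
  ultimately have "(\<Prod>e\<in>{e \<in> vertex_pairs n. e \<inter> Blk \<noteq> {}}. agree_prob p (shift_edges s F) e) =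
      (\<Prod>e\<in>inside. agree_prob p (shift_edges s F) e) * (\<Prod>e\<in>cross. agree_prob p (shift_edges s F) e)"
    by (simp add: prod.union_disjoint)
  moreover have "(\<Prod>e\<in>inside. agree_prob p (shift_edges s F) e) = (\<Prod>e\<in>vertex_pairs m. agree_prob p F e)"
    unfolding inside_def using inj
    by (subst prod.reindex) (auto simp: agree_prob_def edge_prob_shift intro!: prod.cong)
  moreover have "isolation n ^ (2 * m) \<le> (\<Prod>e\<in>cross. agree_prob p (shift_edges s F) e)"
  proof -
    have bnd: "0 \<le> 1 - edge_prob p e \<and> 1 - edge_prob p e \<le> 1" if "e \<in> vertex_pairs n" for e
      using edge_prob_bounds[OF that] by auto
    have "isolation n ^ (2 * m) = (\<Prod>v\<in>Blk. isolation n ^ 2)"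
      by (simp add: Blk_def power_mult)
    also have "\<dots> \<le> (\<Prod>v\<in>Blk. \<Prod>e\<in>{e \<in> vertex_pairs n. v \<in> e}. 1 - edge_prob p e)"
      using s by (intro prod_mono conjI prod_star_ge) (auto simp: Blk_def)
    also have "\<dots> \<le> (\<Prod>e\<in>(\<Union>v\<in>Blk. {e \<in> vertex_pairs n. v \<in> e}). 1 - edge_prob p e)"
      using bnd by (intro prod_UN_ge) (auto simp: Blk_def)
    also have "\<dots> \<le> (\<Prod>e\<in>cross. 1 - edge_prob p e)"
      using bnd by (intro prod_subset_ge) (auto simp: Blk_def cross_def)
    also have "\<dots> = (\<Prod>e\<in>cross. agree_prob p (shift_edges s F) e)"
      using shift_sub by (intro prod.cong) (auto simp: agree_prob_def cross_def)
    finally show ?thesis .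
  qed
  ultimately show ?thesis
    using agree_prob_pos[OF F] by (simp add: Blk_def mult_left_mono)
qed

end

lemma block_index_interval:
  assumes "w \<in> {t * m + 1..t * m + m}"
  shows "(w - 1) div m = (t :: nat)"
proof -
  have "w = (w - t * m) + t * m" "w - t * m \<ge> 1" "w - t * m \<le> m" using assms by auto
  then show ?thesis using block_index[of "w - t * m" m t] by simp
qed

text \<open>For a vertex \<open>v\<close> of block \<open>t\<close> and a distance \<open>d\<close>, only the blocks of \<open>v + d\<close> and \<open>v - d\<close>
  come into question.\<close>

lemma card_conflicting_blocks:
  assumes D: "finite D"
  shows "card {t' \<in> {..<N}. \<exists>v\<in>{t * m + 1..t * m + m}. \<exists>w\<in>{t' * m + 1..t' * m + m}. \<exists>d\<in>D. w = v + d \<or> v = w + d}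
    \<le> 2 * m * card D"
proof -
  define S where "S = (\<lambda>(v, d). (v + d - 1) div m) ` ({t * m + 1..t * m + m} \<times> D)"
  define S' where "S' = (\<lambda>(v, d). (v - d - 1) div m) ` ({t * m + 1..t * m + m} \<times> D)"
  have "{t' \<in> {..<N}. \<exists>v\<in>{t * m + 1..t * m + m}. \<exists>w\<in>{t' * m + 1..t' * m + m}. \<exists>d\<in>D. w = v + d \<or> v = w + d}
      \<subseteq> S \<union> S'"
  proof
    fix t' assume "t' \<in> {t' \<in> {..<N}. \<exists>v\<in>{t * m + 1..t * m + m}. \<exists>w\<in>{t' * m + 1..t' * m + m}. \<exists>d\<in>D. w = v + d \<or> v = w + d}"
    then obtain v w d where vwd: "v \<in> {t * m + 1..t * m + m}" "w \<in> {t' * m + 1..t' * m + m}" "d \<in> D"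
      and eq: "w = v + d \<or> v = w + d" by blast
    from eq show "t' \<in> S \<union> S'"
    proof
      assume "w = v + d"
      then have "t' = (\<lambda>(v, d). (v + d - 1) div m) (v, d)" using block_index_interval[OF vwd(2)] by simp
      then show ?thesis unfolding S_def using vwd by blast
    next
      assume "v = w + d"
      then have "t' = (\<lambda>(v, d). (v - d - 1) div m) (v, d)" using block_index_interval[OF vwd(2)] by simp
      then show ?thesis unfolding S'_def using vwd by blast
    qed
  qed
  then have "card {t' \<in> {..<N}. \<exists>v\<in>{t * m + 1..t * m + m}. \<exists>w\<in>{t' * m + 1..t' * m + m}. \<exists>d\<in>D. w = v + d \<or> v = w + d}
      \<le> card (S \<union> S')"
    using D by (intro card_mono) (auto simp: S_def S'_def)
  also have "\<dots> \<le> card S + card S'" by (rule card_Un_le)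
  also have "\<dots> \<le> card ({t * m + 1..t * m + m} \<times> D) + card ({t * m + 1..t * m + m} \<times> D)"
    unfolding S_def S'_def using D by (intro add_mono card_image_le) auto
  also have "\<dots> = 2 * m * card D" by (simp add: card_cartesian_product)
  finally show ?thesis .
qed

lemma one_minus_power_le_exp:
  fixes x :: real
  assumes "x \<le> 1"
  shows "(1 - x) ^ k \<le> exp (- (x * real k))"
proof -
  have "(1 - x) ^ k \<le> exp (- x) ^ k"
    using assms exp_ge_add_one_self[of "- x"] by (intro power_mono) auto
  then show ?thesis by (simp add: exp_of_nat_mult[symmetric] mult.commute)
qed

context edge_probabilities
begin

lemma random_graph_possible:
  assumes "E \<in> set_pmf (random_graph n p)"
  shows "possible p n E"
proof -
  from assms obtain X where X: "E = {e. X e}"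
    "X \<in> set_pmf (Pi_pmf (vertex_pairs n) False (\<lambda>e. bernoulli_pmf (p (Max e - Min e))))"
    by (auto simp: random_graph_def)
  have sub: "e \<in> vertex_pairs n" if "X e" for e
    using X(2) that by (auto simp: set_Pi_pmf PiE_dflt_def)
  have "edge_prob p e > 0" if "X e" for e
  proof (rule ccontr)
    assume "\<not> edge_prob p e > 0"
    then have "edge_prob p e = 0" using edge_prob_bounds[OF sub[OF that]] by simp
    then have "True \<notin> set_pmf (bernoulli_pmf (p (Max e - Min e)))"
      by (simp add: edge_prob_def set_pmf_iff)
    moreover have "X e \<in> set_pmf (bernoulli_pmf (p (Max e - Min e)))"
      using X(2) sub[OF that] by (auto simp: set_Pi_pmf PiE_dflt_def)
    ultimately show False using that by simp
  qed
  then show ?thesis using sub unfolding possible_def X(1) by auto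
qed

text \<open>Cut \<open>{1..n}\<close> into blocks of length \<open>m\<close>, and call two blocks conflicting if some pair between
  them has positive edge probability. Few distances have positive probability, so each block
  conflicts with few others, and there is a large conflict-free family \<open>T\<close>. For its members, the
  sets of relevant pairs are disjoint, hence the events ``block \<open>t\<close> is an isolated copy'' are
  independent.\<close>

lemma prob_no_isolated_copy_le:
  assumes F: "possible p m F"
  defines "q \<equiv> (\<Prod>e\<in>vertex_pairs m. agree_prob p F e)"
  shows "measure_pmf.prob (random_graph n p) {E. \<nexists>s. isolated_copy n E s m F}
    \<le> exp (- (q * isolation n ^ (2 * m) * (real (n div m) / real (Suc (2 * m * num_distances n)))))"
proof -
  define Blk where "Blk t = {t * m + 1..t * m + m}" for t
  define conf where "conf t t' \<longleftrightarrow> (\<exists>e\<in>vertex_pairs n. edge_prob p e > 0 \<and> e \<inter> Blk t \<noteq> {} \<and> e \<inter> Blk t' \<noteq> {} \<and> t \<noteq> t')"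
    for t t'
  define D where "D = {d \<in> {1..<n}. p d > 0}"
  have deg: "card {t' \<in> {..<n div m}. conf t t'} \<le> 2 * m * num_distances n" for t
  proof -
    have "{t' \<in> {..<n div m}. conf t t'} \<subseteq>
        {t' \<in> {..<n div m}. \<exists>v\<in>Blk t. \<exists>w\<in>Blk t'. \<exists>d\<in>D. w = v + d \<or> v = w + d}"
    proof safe
      fix t' assume "conf t t'"
      then obtain e a b where e: "e \<in> vertex_pairs n" "edge_prob p e > 0" "t \<noteq> t'"
        and ab: "a \<in> e" "a \<in> Blk t" "b \<in> e" "b \<in> Blk t'"
        by (auto simp: conf_def)
      have "a \<noteq> b" using ab(2,4) e(3) block_index_interval unfolding Blk_def by metis
      from e(1) obtain v w where vw: "e = {v, w}" "1 \<le> v" "v < w" "w \<le> n" "edge_prob p e = p (w - v)"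
        by (rule vertex_pairs_D[of _ _ p])
      then have "w - v \<in> D" using e(2) by (auto simp: D_def)
      moreover have "b = a + (w - v) \<or> a = b + (w - v)"
        using ab(1,3) \<open>a \<noteq> b\<close> vw by auto
      ultimately show "\<exists>v\<in>Blk t. \<exists>w\<in>Blk t'. \<exists>d\<in>D. w = v + d \<or> v = w + d"
        using ab(2,4) by blast
    qed
    then have "card {t' \<in> {..<n div m}. conf t t'} \<le>
        card {t' \<in> {..<n div m}. \<exists>v\<in>Blk t. \<exists>w\<in>Blk t'. \<exists>d\<in>D. w = v + d \<or> v = w + d}"
      by (intro card_mono) auto
    also have "\<dots> \<le> 2 * m * card D"
      unfolding Blk_def by (rule card_conflicting_blocks) (simp add: D_def)
    finally show ?thesis by (simp add: num_distances_def D_def)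
  qed
  obtain T where T: "T \<subseteq> {..<n div m}" "card {..<n div m} \<le> Suc (2 * m * num_distances n) * card T"
    and indep: "\<And>t t'. t \<in> T \<Longrightarrow> t' \<in> T \<Longrightarrow> t \<noteq> t' \<Longrightarrow> \<not> conf t t'"
    using large_independent_subset[of "{..<n div m}" conf, OF _ _ deg] unfolding conf_def by blast
  have finT: "finite T" using T(1) finite_subset by blast
  have le_n: "t * m + m \<le> n" if "t \<in> T" for t
  proof -
    have "Suc t * m \<le> (n div m) * m" using that T(1) by (intro mult_right_mono) auto
    also have "\<dots> \<le> n" by simp
    finally show ?thesis by simp
  qed
  define touch where "touch t = {e \<in> vertex_pairs n. e \<inter> Blk t \<noteq> {}}" for t
  \<comment> \<open>Pairs of probability zero are left out: they are almost surely absent, and without them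
    the sets \<open>B t\<close> are disjoint.\<close>
  define B where "B t = {e \<in> touch t. edge_prob p e > 0}" for t
  \<comment> \<open>One pattern serves all blocks, as the translates of \<open>F\<close> lie in disjoint sets \<open>B t\<close>.\<close>
  define x where "x e \<longleftrightarrow> (\<exists>t\<in>T. e \<in> shift_edges (t * m) F)" for e
  define P where "P e = bernoulli_pmf (p (Max e - Min e))" for e
  have shift: "e \<in> B t" if "e \<in> shift_edges (t * m) F" "t \<in> T" for e t
  proof -
    from that obtain f where f: "f \<in> F" "e = (\<lambda>v. v + t * m) ` f"
      by (auto simp: shift_edges_def)
    then have "f \<subseteq> {1..m}" "f \<noteq> {}" using F by (auto simp: possible_def vertex_pairs_def)
    then obtain u where "u \<in> f" "u \<in> {1..m}" by blast
    then have "u + t * m \<in> e \<inter> Blk t" using f(2) by (auto simp: Blk_def)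
    then have "e \<inter> Blk t \<noteq> {}" by blast
    then show ?thesis
      using possible_shift[OF F le_n[OF that(2)]] that(1) by (auto simp: possible_def B_def touch_def)
  qed
  have disj: "B t \<inter> B t' = {}" if "t \<in> T" "t' \<in> T" "t \<noteq> t'" for t t'
    using indep[OF that] that(3) by (auto simp: B_def touch_def conf_def)
  have x_iff: "x e \<longleftrightarrow> e \<in> shift_edges (t * m) F" if "t \<in> T" "e \<in> B t" for t e
    using that shift disj unfolding x_def by blast
  have match: "(\<Prod>e\<in>B t. pmf (P e) (x e)) = (\<Prod>e\<in>touch t. agree_prob p (shift_edges (t * m) F) e)"
    if t: "t \<in> T" for t
  proof (rule prod.mono_neutral_cong_left)
    show "\<forall>e\<in>touch t - B t. agree_prob p (shift_edges (t * m) F) e = 1"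
    proof
      fix e assume e: "e \<in> touch t - B t"
      then have "e \<notin> shift_edges (t * m) F" using shift[OF _ t] by blast
      moreover have "edge_prob p e = 0"
        using e edge_prob_bounds[of e n] by (auto simp: B_def touch_def)
      ultimately show "agree_prob p (shift_edges (t * m) F) e = 1" by (simp add: agree_prob_def)
    qed
    show "pmf (P e) (x e) = agree_prob p (shift_edges (t * m) F) e" if "e \<in> B t" for e
      using that x_iff[OF t that] edge_prob_bounds[of e n]
      by (simp add: P_def agree_prob_def edge_prob_def B_def touch_def less_imp_le)
  qed (auto simp: B_def touch_def)
  define \<epsilon> where "\<epsilon> = q * isolation n ^ (2 * m)"
  have \<epsilon>_nonneg: "\<epsilon> \<ge> 0"
    unfolding \<epsilon>_def q_def using agree_prob_pos[OF F] isolation_nonneg by (intro mult_nonneg_nonneg) auto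
  have \<epsilon>_le: "\<epsilon> \<le> (\<Prod>e\<in>B t. pmf (P e) (x e))" if "t \<in> T" for t
    unfolding match[OF that] \<epsilon>_def q_def touch_def Blk_def
    using isolated_copy_prob_ge[OF F le_n[OF that]] by simp
  have match_le_1: "(\<Prod>e\<in>B t. pmf (P e) (x e)) \<le> 1" for t
    by (intro prod_le_1) (auto simp: pmf_le_1)
  have "measure_pmf.prob (random_graph n p) {E. \<nexists>s. isolated_copy n E s m F} =
      measure_pmf.prob (Pi_pmf (vertex_pairs n) False P) {X. \<nexists>s. isolated_copy n {e. X e} s m F}"
    by (simp add: random_graph_def P_def[abs_def] vimage_def)
  also have "\<dots> \<le> measure_pmf.prob (Pi_pmf (vertex_pairs n) False P)
      {X. (\<forall>e\<in>{}. X e = x e) \<and> (\<forall>t\<in>T. \<exists>e\<in>B t. X e \<noteq> x e)}"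
  proof (rule measure_pmf.finite_measure_mono_AE)
    have "isolated_copy n {e. X e} (t * m) m F"
      if X: "X \<in> set_pmf (Pi_pmf (vertex_pairs n) False P)" and t: "t \<in> T" and eq: "\<forall>e\<in>B t. X e = x e"
      for X t
      unfolding isolated_copy_def
    proof (intro conjI ballI impI le_n t)
      fix e assume e: "e \<in> vertex_pairs n" "e \<inter> {t * m + 1..t * m + m} \<noteq> {}"
      show "e \<in> {e. X e} \<longleftrightarrow> e \<in> shift_edges (t * m) F"
      proof (cases "e \<in> B t")
        case True
        then show ?thesis using eq x_iff[OF t] by simp
      next
        case False
        then have "\<not> edge_prob p e > 0" using e by (auto simp: B_def touch_def Blk_def)
        moreover have "{e. X e} \<in> set_pmf (random_graph n p)"
          using X by (auto simp: random_graph_def P_def[abs_def])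
        ultimately have "\<not> X e"
          using random_graph_possible by (auto simp: possible_def)
        then show ?thesis using False shift[OF _ t] by auto
      qed
    qed
    then show "AE X in measure_pmf (Pi_pmf (vertex_pairs n) False P).
        X \<in> {X. \<nexists>s. isolated_copy n {e. X e} s m F} \<longrightarrow>
        X \<in> {X. (\<forall>e\<in>{}. X e = x e) \<and> (\<forall>t\<in>T. \<exists>e\<in>B t. X e \<noteq> x e)}"
      unfolding AE_measure_pmf_iff mem_Collect_eq by blast
  qed simp
  also have "\<dots> = (\<Prod>e\<in>{}. pmf (P e) (x e)) * (\<Prod>t\<in>T. 1 - (\<Prod>e\<in>B t. pmf (P e) (x e)))"
  proof (rule prob_no_block_matches)
    show "disjoint_family_on B T" unfolding disjoint_family_on_def using disj by blast
  qed (use finT in \<open>auto simp: B_def touch_def\<close>)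
  also have "\<dots> = (\<Prod>t\<in>T. 1 - (\<Prod>e\<in>B t. pmf (P e) (x e)))" by simp
  also have "\<dots> \<le> (\<Prod>t\<in>T. 1 - \<epsilon>)"
    using \<epsilon>_le match_le_1 by (intro prod_mono) auto
  also have "\<dots> = (1 - \<epsilon>) ^ card T" by simp
  also have "\<dots> \<le> exp (- (\<epsilon> * real (card T)))"
  proof (cases "T = {}")
    case False
    then have "\<epsilon> \<le> 1" using \<epsilon>_le match_le_1 by (meson ex_in_conv order_trans)
    then show ?thesis by (rule one_minus_power_le_exp)
  qed simp
  also have "\<dots> \<le> exp (- (\<epsilon> * (real (n div m) / real (Suc (2 * m * num_distances n)))))"
  proof -
    have "real (n div m) \<le> real (Suc (2 * m * num_distances n)) * real (card T)"
      using T(2) by (simp only: card_lessThan of_nat_mult[symmetric] of_nat_le_iff)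
    then have "real (n div m) / real (Suc (2 * m * num_distances n)) \<le> real (card T)"
      by (subst pos_divide_le_eq) (simp_all only: mult.commute of_nat_0_less_iff zero_less_Suc)
    then show ?thesis
      unfolding exp_le_cancel_iff neg_le_iff_le using \<epsilon>_nonneg by (rule mult_left_mono)
  qed
  finally show ?thesis by (simp add: \<epsilon>_def)
qed

end

section \<open>The zero-one law for sparse distance sequences\<close>

text \<open>Up to constant factors, there are at least \<open>n / (num_distances n + 1)\<close> independent blocks, and
  each of them is an isolated copy of a given graph with probability at least some power of
  \<open>isolation n\<close>. The condition thus makes the expected number of
  isolated copies among them tend to infinity, whatever the size of the graph to be found.\<close>

locale sparse_edge_probabilities = edge_probabilities +
  assumes sparse: "\<And>M. filterlim (\<lambda>n. real n * isolation n ^ M / real (Suc (num_distances n))) at_top sequentially"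
begin

lemma prob_no_isolated_copy_tendsto_0:
  assumes F: "possible p m F" and m: "m \<ge> 1"
  shows "(\<lambda>n. measure_pmf.prob (random_graph n p) {E. \<nexists>s. isolated_copy n E s m F}) \<longlonglongrightarrow> 0"
proof -
  define q where "q = (\<Prod>e\<in>vertex_pairs m. agree_prob p F e)"
  have q: "q > 0" unfolding q_def by (rule agree_prob_pos[OF F])
  define w where "w n = real n * isolation n ^ (2 * m) / real (Suc (num_distances n))" for n
  define K where "K = q / (4 * real m ^ 2)"
  have "K > 0" using q m by (simp add: K_def)
  have bound: "measure_pmf.prob (random_graph n p) {E. \<nexists>s. isolated_copy n E s m F} \<le> exp (- (K * w n))"
    if "n \<ge> m" for n
  proof -
    have "1 \<le> n div m" using that m by (simp add: Suc_le_eq div_greater_zero_iff)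
    then have "m \<le> m * (n div m)" using mult_le_mono2 by fastforce
    moreover have "n mod m < m" using m by simp
    moreover have "m * (n div m) + n mod m = n" by simp
    ultimately have "n \<le> 2 * (m * (n div m))" by linarith
    then have "n \<le> 2 * m * (n div m)" by (simp only: mult.assoc)
    then have "real n \<le> 2 * real m * real (n div m)"
      by (metis of_nat_le_iff of_nat_mult of_nat_numeral)
    then have num: "real n / (2 * real m) \<le> real (n div m)"
      using m by (simp add: divide_le_eq mult.commute)
    have "Suc (2 * m * num_distances n) \<le> 2 * m * Suc (num_distances n)" using m by simp
    then have den: "real (Suc (2 * m * num_distances n)) \<le> 2 * real m * real (Suc (num_distances n))"
      by (metis of_nat_le_iff of_nat_mult of_nat_numeral)
    have "real n / (2 * real m) / (2 * real m * real (Suc (num_distances n))) \<le>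
        real (n div m) / real (Suc (2 * m * num_distances n))"
      by (rule frac_le[OF _ num _ den]) (simp_all only: of_nat_0_le_iff of_nat_0_less_iff zero_less_Suc)
    then have "q * isolation n ^ (2 * m) * (real n / (2 * real m) / (2 * real m * real (Suc (num_distances n)))) \<le>
        q * isolation n ^ (2 * m) * (real (n div m) / real (Suc (2 * m * num_distances n)))"
      using q isolation_nonneg by (intro mult_left_mono) auto
    moreover have "q * isolation n ^ (2 * m) * (real n / (2 * real m) / (2 * real m * real (Suc (num_distances n)))) = K * w n"
      by (simp add: K_def w_def power2_eq_square mult_ac)
    ultimately have "exp (- (q * isolation n ^ (2 * m) * (real (n div m) / real (Suc (2 * m * num_distances n)))))
        \<le> exp (- (K * w n))"
      by simp
    with prob_no_isolated_copy_le[OF F, of n] show ?thesis unfolding q_def by (rule order_trans)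
  qed
  have "filterlim (\<lambda>n. K * w n) at_top sequentially"
    unfolding w_def using \<open>K > 0\<close> sparse by (intro filterlim_tendsto_pos_mult_at_top[OF tendsto_const])
  then have "filterlim (\<lambda>n. - (K * w n)) at_bot sequentially"
    by (simp add: filterlim_uminus_at_top)
  then have "(\<lambda>n. exp (- (K * w n))) \<longlonglongrightarrow> 0"
    by (rule filterlim_compose[OF exp_at_bot])
  then show ?thesis
  proof (rule Lim_null_comparison[rotated])
    show "\<forall>\<^sub>F n in sequentially. norm (measure_pmf.prob (random_graph n p) {E. \<nexists>s. isolated_copy n E s m F})
        \<le> exp (- (K * w n))"
      using bound by (auto intro: eventually_sequentiallyI[of m])
  qed
qed

text \<open>Call a graph of positive probability rich if it has isolated stacks of height \<open>k\<close> of
  representatives of all types that are realised by graphs of positive probability. A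
  rich graph absorbs every graph of positive probability, so any two rich graphs absorb each other
  and satisfy the same sentences of depth less than \<open>k\<close>. Since only finitely many
  representatives occur, the random graph is rich with probability tending to \<open>1\<close>.\<close>

theorem sparse_zero_one_law:
  assumes \<psi>: "sentence \<psi>"
  shows "zero_one_law p \<psi>"
proof -
  \<comment> \<open>One more than the quantifier depth, so that stacks are never empty.\<close>
  define k where "k = Suc (quantifier_depth \<psi>)"
  define \<G> where "\<G> = {({1..m}, F) |m F. m \<ge> 1 \<and> possible p m F}"
  obtain \<C> where \<C>: "finite \<C>" "\<C> \<subseteq> \<G>"
    and rep: "\<And>V E. (V, E) \<in> \<G> \<Longrightarrow> \<exists>(V', E')\<in>\<C>. ef_equiv k V' E' V E {}"
    using ef_equiv_finite_representatives[of \<G> k] by metis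
  define copy where "copy n E c \<longleftrightarrow> (\<exists>s. isolated_copy n E s (k * card (fst c)) (stack k (card (fst c)) (snd c)))"
    for n E and c :: "nat set \<times> nat set set"
  define rich where "rich n E \<longleftrightarrow> possible p n E \<and> (\<forall>c\<in>\<C>. copy n E c)" for n E
  have pieces: "\<exists>c. no_crossing c {1..n} E \<and> c ` {1..n} \<subseteq> {..k} \<and>
      (\<forall>i\<in>{1..k}. ef_equiv k (piece c {1..n} i) E {1..n'} E' {})"
    if "rich n E" "possible p n' E'" "n' \<ge> 1" for n E n' E'
  proof -
    have "({1..n'}, E') \<in> \<G>" using that by (auto simp: \<G>_def)
    then obtain m F where mF: "({1..m}, F) \<in> \<C>" "possible p m F" "ef_equiv k {1..m} F {1..n'} E' {}"
      using rep[of "{1..n'}" E'] \<C>(2) by (auto simp: \<G>_def)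
    have "copy n E ({1..m}, F)" using that(1) mF(1) unfolding rich_def by blast
    then obtain s where s: "isolated_copy n E s (k * m) (stack k m F)"
      by (auto simp: copy_def)
    have sub: "F \<subseteq> vertex_pairs m" "E \<subseteq> vertex_pairs n"
      using mF(2) that(1) by (auto simp: possible_def rich_def)
    from isolated_stack_pieces[OF sub s] obtain c where c: "no_crossing c {1..n} E" "c ` {1..n} \<subseteq> {..k}"
      "\<forall>i\<in>{1..k}. \<forall>l. ef_equiv l (piece c {1..n} i) E {1..m} F {}"
      by (elim exE conjE) (rule that)
    then have "ef_equiv k (piece c {1..n} i) E {1..n'} E' {}" if "i \<in> {1..k}" for i
      using ef_equiv_trans[OF c(3)[rule_format, OF that] mF(3)] by simp
    then show ?thesis using c(1,2) by blast
  qed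
  have agree: "satisfies {1..n} E \<psi> \<longleftrightarrow> satisfies {1..n'} E' \<psi>"
    if "rich n E" "rich n' E'" "n \<ge> 1" "n' \<ge> 1" for n E n' E'
  proof -
    have "possible p n E" "possible p n' E'" using that by (auto simp: rich_def)
    with that pieces[of n E n' E'] pieces[of n' E' n E] obtain c d where
      cd: "no_crossing c {1..n} E" "c ` {1..n} \<subseteq> {..k}"
        "no_crossing d {1..n'} E'" "d ` {1..n'} \<subseteq> {..k}"
      and copies: "\<forall>i\<in>{1..k}. ef_equiv k (piece c {1..n} i) E {1..n'} E' {}"
        "\<forall>i\<in>{1..k}. ef_equiv k (piece d {1..n'} i) E' {1..n} E {}"
      by auto
    have "ef_equiv k {1..n} E {1..n'} E' {}"
      by (rule ef_equiv_mutual_absorb[OF cd(1,2) _ cd(3,4)]) (use copies in blast)+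
    then show ?thesis
      by (rule ef_equiv_satisfies) (use that \<psi> in \<open>auto simp: k_def\<close>)
  qed
  define poor where "poor n = measure_pmf.prob (random_graph n p) {E. \<not> rich n E}" for n
  have "poor \<longlonglongrightarrow> 0"
  proof (rule Lim_null_comparison)
    show "(\<lambda>n. \<Sum>c\<in>\<C>. measure_pmf.prob (random_graph n p) {E. \<not> copy n E c}) \<longlonglongrightarrow> 0"
    proof (rule tendsto_null_sum)
      fix c assume "c \<in> \<C>"
      then obtain m F where mF: "c = ({1..m}, F)" "m \<ge> 1" "possible p m F"
        using \<C>(2) by (auto simp: \<G>_def)
      have "k * m \<ge> 1" using mF(2) by (simp add: k_def)
      then show "(\<lambda>n. measure_pmf.prob (random_graph n p) {E. \<not> copy n E c}) \<longlonglongrightarrow> 0"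
        using prob_no_isolated_copy_tendsto_0[OF possible_stack[OF mF(3)]] by (simp add: copy_def mF(1))
    qed
    have "poor n \<le> (\<Sum>c\<in>\<C>. measure_pmf.prob (random_graph n p) {E. \<not> copy n E c})" for n
    proof -
      have "poor n \<le> measure_pmf.prob (random_graph n p) (\<Union>c\<in>\<C>. {E. \<not> copy n E c})"
        unfolding poor_def using random_graph_possible
        by (intro measure_pmf.finite_measure_mono_AE) (auto simp: AE_measure_pmf_iff rich_def)
      also have "\<dots> \<le> (\<Sum>c\<in>\<C>. measure_pmf.prob (random_graph n p) {E. \<not> copy n E c})"
        using \<C>(1) by (intro measure_pmf.finite_measure_subadditive_finite) auto
      finally show ?thesis .
    qed
    then show "\<forall>\<^sub>F n in sequentially. norm (poor n) \<le>
        (\<Sum>c\<in>\<C>. measure_pmf.prob (random_graph n p) {E. \<not> copy n E c})"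
      by (simp add: poor_def)
  qed
  show ?thesis
  proof (cases "\<exists>n E. n \<ge> 1 \<and> rich n E \<and> satisfies {1..n} E \<psi>")
    case True
    then have sat: "satisfies {1..n} E \<psi>" if "n \<ge> 1" "rich n E" for n E
      using agree that by metis
    have "1 - poor n \<le> Prob n p \<psi>" if "n \<ge> 1" for n
    proof -
      have "1 - poor n = measure_pmf.prob (random_graph n p) (UNIV - {E. \<not> rich n E})"
        unfolding poor_def by (subst measure_pmf.prob_compl[symmetric]) auto
      also have "\<dots> \<le> Prob n p \<psi>"
        unfolding Prob_def using sat that by (intro measure_pmf.finite_measure_mono) auto
      finally show ?thesis .
    qed
    then have lower: "\<forall>\<^sub>F n in sequentially. 1 - poor n \<le> Prob n p \<psi>"
      by (auto intro: eventually_sequentiallyI[of 1])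
    have "(\<lambda>n. Prob n p \<psi>) \<longlonglongrightarrow> 1"
    proof (rule tendsto_sandwich[OF lower])
      show "(\<lambda>n. 1 - poor n) \<longlonglongrightarrow> 1"
        using tendsto_diff[OF tendsto_const[of 1] \<open>poor \<longlonglongrightarrow> 0\<close>] by simp
    qed (auto simp: Prob_def)
    then show ?thesis by (simp add: zero_one_law_def)
  next
    case False
    have "Prob n p \<psi> \<le> poor n" if "n \<ge> 1" for n
      unfolding Prob_def poor_def using False that by (intro measure_pmf.finite_measure_mono) auto
    then have "(\<lambda>n. Prob n p \<psi>) \<longlonglongrightarrow> 0"
      by (intro Lim_null_comparison[OF _ \<open>poor \<longlonglongrightarrow> 0\<close>] eventually_sequentiallyI[of 1])
         (simp add: Prob_def)
    then show ?thesis by (simp add: zero_one_law_def)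
  qed
qed

end

section \<open>Inserting zeros\<close>

theorem mainTheorem2:
  fixes a :: "nat \<Rightarrow> real"
  assumes "\<forall>i\<ge>1. 0 \<le> a i \<and> a i < 1"
  shows "\<exists>f :: nat \<Rightarrow> nat. \<forall>(g :: nat \<Rightarrow> nat) (p :: nat \<Rightarrow> real).
           (\<forall>i\<ge>1. g i > f i) \<and> inserts_zeros a g p \<longrightarrow>
           (\<forall>\<psi>. sentence \<psi> \<longrightarrow> zero_one_law p \<psi>)"
proof -
  define A where "A l = (\<Prod>i\<in>{1..l}. 1 - a i)" for l
  have A_pos: "0 < A l" for l
    unfolding A_def using assms by (intro prod_pos) auto
  have A_le_1: "A l \<le> 1" for l
    unfolding A_def using assms by (intro prod_le_1) (auto simp: less_imp_le)
  \<comment> \<open>The \<open>Suc i\<close>-th distance \<open>d (Suc i)\<close> exceeds \<open>g i\<close>, hence \<open>f i\<close>. With \<open>l = Suc i\<close>, every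
    \<open>n > d l\<close> is thus above \<open>(l / A l) ^ l\<close>, while \<open>A l\<close> and \<open>l\<close> are the values relevant for
    \<open>isolation n\<close> and \<open>num_distances n\<close> as long as \<open>n \<le> d (Suc l)\<close>. The exponent \<open>l\<close> finally
    exceeds each fixed power \<open>M\<close>.\<close>
  define f where "f i = nat \<lceil>(real (Suc i) / A (Suc i)) ^ Suc i\<rceil>" for i
  have "zero_one_law p \<psi>"
    if g: "\<forall>i\<ge>1. g i > f i" and ins: "inserts_zeros a g p" and \<psi>: "sentence \<psi>" for g p \<psi>
  proof -
    define d where "d i = i + (\<Sum>j=1..<i. g j)" for i
    have p_d: "p (d i) = a i" if "i \<ge> 1" for i
      using ins that by (simp add: inserts_zeros_def d_def)
    have p_0: "p m = 0" if "m \<ge> 1" "\<And>i. i \<ge> 1 \<Longrightarrow> m \<noteq> d i" for m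
      using ins that by (simp add: inserts_zeros_def d_def)
    have bounds: "0 \<le> p m \<and> p m < 1" if "m \<ge> 1" for m
      using p_0[OF that] p_d assms by (metis less_eq_real_def zero_less_one)
    interpret edge_probabilities p
      by unfold_locales (use bounds in auto)
    have d_Suc: "d (Suc i) = Suc (d i + (if i \<ge> 1 then g i else 0))" for i
      by (cases "i \<ge> 1") (auto simp: d_def)
    have d_mono: "strict_mono d"
      unfolding strict_mono_Suc_iff by (simp add: d_Suc)
    have d_ge: "i \<le> d i" for i by (simp add: d_def)
    have large: "(real l / A l) ^ l \<le> real (d l)" if l: "l \<ge> 2" for l
    proof -
      from l obtain i where i: "l = Suc i" "i \<ge> 1" by (cases l) auto
      have "(real l / A l) ^ l \<le> real (f i)" unfolding f_def i(1) by (rule real_nat_ceiling_ge)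
      also have "f i \<le> d l" using g i d_Suc[of i] by (simp add: less_imp_le le_SucI trans_le_add2)
      finally show ?thesis by simp
    qed
    have growth: "real l / 2 \<le> real n * isolation n ^ M / real (Suc (num_distances n))"
      if l: "M + 2 \<le> l" "d l < n" "n \<le> d (Suc l)" for l n M
    proof -
      have in_range: "x \<in> d ` {1..l}" if "x \<in> {1..<n}" "p x \<noteq> 0" for x
      proof -
        from that p_0[of x] obtain i where i: "i \<ge> 1" "x = d i" by auto
        then have "d i < d (Suc l)" using that(1) l(3) by simp
        then have "i < Suc l" using d_mono by (simp add: strict_mono_less)
        then show ?thesis using i by auto
      qed
      have d_sub: "d ` {1..l} \<subseteq> {1..<n}"
      proof
        fix x assume "x \<in> d ` {1..l}"
        then obtain i where i: "i \<in> {1..l}" "x = d i" by blast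
        then have "d i \<le> d l" using d_mono by (simp add: strict_mono_less_eq)
        then show "x \<in> {1..<n}" using i l(2) d_ge[of i] by auto
      qed
      have inj: "inj_on d {1..l}" using d_mono strict_mono_imp_inj_on inj_on_subset by blast
      have "isolation n = (\<Prod>x\<in>d ` {1..l}. 1 - p x)"
        unfolding isolation_def
      proof (intro prod.mono_neutral_right ballI)
        fix x assume "x \<in> {1..<n} - d ` {1..l}"
        then have "p x = 0" using in_range by blast
        then show "1 - p x = 1" by simp
      qed (use d_sub in auto)
      also have "\<dots> = A l"
        unfolding A_def prod.reindex[OF inj] by (intro prod.cong) (auto simp: p_d)
      finally have iso: "isolation n = A l" .
      have "num_distances n \<le> card (d ` {1..l})"
        unfolding num_distances_def using in_range by (intro card_mono) auto
      also have "\<dots> \<le> l" using card_image_le[of "{1..l}" d] by simp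
      finally have num: "real (Suc (num_distances n)) \<le> real l + 1" by simp
      have l1: "real l \<ge> 1" using l(1) by simp
      have "real l \<ge> A l" using A_le_1[of l] l1 by simp
      then have ratio: "1 \<le> real l / A l" using A_pos[of l] by simp
      have "real l ^ 2 * 1 \<le> real l ^ (M + 2) * (1 / A l ^ 2)"
        using l1 A_pos[of l] A_le_1[of l]
        by (intro mult_mono power_increasing) (auto simp: power_le_one)
      also have "\<dots> = (real l / A l) ^ (M + 2) * A l ^ M"
        using A_pos[of l] by (simp add: power_divide power_add power2_eq_square)
      also have "\<dots> \<le> (real l / A l) ^ l * A l ^ M"
        using ratio l(1) A_pos[of l] by (intro mult_right_mono power_increasing) auto
      also have "\<dots> \<le> real n * A l ^ M"
        using large[of l] l A_pos[of l] by (intro mult_right_mono) auto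
      finally have "real l ^ 2 \<le> real n * isolation n ^ M" by (simp add: iso)
      have "real l / 2 \<le> real l ^ 2 / (real l + 1)"
        using l1 by (simp add: field_simps power2_eq_square)
      also have "\<dots> \<le> real n * isolation n ^ M / real (Suc (num_distances n))"
        using \<open>real l ^ 2 \<le> real n * isolation n ^ M\<close> num
        by (intro frac_le) (auto simp: isolation_nonneg)
      finally show ?thesis .
    qed
    interpret sparse_edge_probabilities p
    proof
      fix M
      show "filterlim (\<lambda>n. real n * isolation n ^ M / real (Suc (num_distances n))) at_top sequentially"
        unfolding filterlim_at_top
      proof
        fix Z :: real
        define i where "i = max (M + 2) (nat \<lceil>2 * Z\<rceil>)"
        have "Z \<le> real n * isolation n ^ M / real (Suc (num_distances n))" if n: "n > d i" for n
        proof -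
          define l where "l = Max {i. d i < n}"
          have "j \<le> n" if "d j < n" for j using d_ge[of j] that by simp
          then have "{i. d i < n} \<subseteq> {..n}" by auto
          then have fin: "finite {i. d i < n}" by (rule finite_subset) simp
          have "l \<in> {i. d i < n}" unfolding l_def using fin n by (intro Max_in) auto
          moreover have "i \<le> l" unfolding l_def using fin n by (intro Max_ge) auto
          moreover have "n \<le> d (Suc l)"
            using Max_ge[OF fin, of "Suc l"] unfolding l_def[symmetric] by (cases "d (Suc l) < n") auto
          ultimately have "real l / 2 \<le> real n * isolation n ^ M / real (Suc (num_distances n))"
            by (intro growth) (auto simp: i_def)
          moreover have "2 * Z \<le> real l"
            using \<open>i \<le> l\<close> unfolding i_def by linarith
          ultimately show ?thesis by linarith
        qed
        then show "\<forall>\<^sub>F n in sequentially. Z \<le> real n * isolation n ^ M / real (Suc (num_distances n))"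
          by (intro eventually_sequentiallyI[of "Suc (d i)"]) auto
      qed
    qed
    show ?thesis using \<psi> by (rule sparse_zero_one_law)
  qed
  then show ?thesis by blast
qed

end
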